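(* Let $\sigma$ be a finite relational signature, $(\mathcal A_0,P)$ an instance of the extension problem for partial automorphisms in the class of all $\sigma$-structures, and let $\mathcal A$ be any finite, fully symmetric solution to this instance whose atlas is $N$-acyclic. (a) Then $\mathcal A$ is $N$-universal within the class $\mathcal C_0=\mathcal C_0(\mathcal A_0,P)$ of all (finite or infinite) solutions to the instance $(\mathcal A_0,P)$. (b) Let the class $\mathcal C$ of $\sigma$-structures be defined in terms of forbidden homomorphisms, and let $N$ be an upper bound for the sizes of the forbidden structures that define $\mathcal C$. Then $\mathcal A\in\mathcal C$ (so $\mathcal A$ belongs to the class $\mathcal C_{\mathrm{fin}}$ of finite structures in $\mathcal C$) if the instance $(\mathcal A_0,P)$ has any finite or infinite solution in $\mathcal C$. This implies the extension property for partial automorphisms (EPPA) for the class $\mathcal C$.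
   Context: Structures have non-empty universes; substructures are induced. A partial isomorphism in $\mathcal A_0$ is an isomorphism between induced substructures of $\mathcal A_0$ (possibly empty). **Extension problem and EPPA.** An instance of the extension problem for partial automorphisms over a class $\mathcal C$ of $\sigma$-structures is a pair $(\mathcal A_0,P)$ of a finite $\mathcal A_0\in\mathcal C$ and a set $P$ of partial isomorphisms in $\mathcal A_0$, always assumed closed under inverses. A solution is any $\mathcal A\in\mathcal C$ into which $\mathcal A_0$ embeds isomorphically (onto an induced substructure) such that the image of each $p\in P$ extends to a full automorphism of $\mathcal A$. $\mathcal C$ has EPPA if every instance over $\mathcal C$ that admits any solution in $\mathcal C$ also admits a finite solution in $\mathcal C$. $\mathcal C$ is defined in terms of forbidden homomorphisms if there is a finite set $X$ of finite $\sigma$-structures (the forbidden structures) such that $\mathcal C$ is the class of those $\sigma$-structures $\mathcal A$ that admit no homomorphism $h\colon\mathcal X\to\mathcal A$ from any $\mathcal X\in X$. **Fully symmetric solutions.** A solution $\mathcal A$ is fully symmetric if it possesses an atlas with single co-ordinate structure $\mathcal A_0$, that is, a set of charts $\pi\colon\mathcal A\restriction u\simeq\mathcal A_0$ (isomorphisms, with co-ordinate domains $u\subseteq A$; several charts may have the same domain), $U$ denoting the set of co-ordinate domains, such that every element of $A$ and every tuple in every relation of $\mathcal A$ is contained in some $u\in U$, and such that: (i) the group of those automorphisms $f$ of $\mathcal A$ for which $\pi\mapsto\pi\circ f^{-1}$ is a permutation of the set of charts acts transitively on the set of charts (hence on $U$); (ii) for any two charts $\pi_u,\pi_{u'}$ whose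 domains $u,u'$ have non-empty intersection there is a finite sequence $p_1,\dots,p_n$ ($n\geq0$) in $P$ with $\pi_{u'}\circ\pi_u^{-1}=p_n\circ\cdots\circ p_1$ as partial maps (equality includes the domains; the left-hand side has domain $\pi_u(u\cap u')$; the empty composition is $\mathrm{id}_{A_0}$). **Hypergraph acyclicity.** A hypergraph $(A,U)$ consists of a vertex set $A$ and a set $U$ of finite non-empty subsets of $A$ with $A=\bigcup U$. Its Gaifman graph links distinct $a,a'$ that lie in a common hyperedge. It is acyclic if its Gaifman graph has no chordless cycles of length greater than $3$ and every clique in the Gaifman graph is contained in some hyperedge. It is $N$-acyclic if every induced sub-hypergraph (vertex set $A_0\subseteq A$, hyperedges the non-empty sets $u\cap A_0$, $u\in U$) with up to $N$ vertices is acyclic. An atlas is $N$-acyclic if the hypergraph $(A,U)$ of its co-ordinate domains is; for a fully symmetric solution this refers to the atlas witnessing full symmetry. **Universality.** A $\sigma$-structure $\mathcal A$ is $N$-universal within a class $\mathcal C_0$ of $\sigma$-structures if every substructure of $\mathcal A$ of size up to $N$ admits homomorphisms to every structure in $\mathcal C_0$. *)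

theory Defs
  imports Main
begin

record 's signature =
  symbols :: "'s set"
  arity :: "'s \<Rightarrow> nat"

record ('s, 'a) struct =
  universe :: "'a set"
  rel :: "'s \<Rightarrow> 'a list set"

text \<open>Symbols outside the signature are interpreted by the empty relation, so notions such as
  homomorphism can quantify over all of \<open>'s\<close> without mentioning the signature.\<close>

definition Str :: "'s signature \<Rightarrow> ('s, 'a) struct set" where
  "Str \<sigma> = {A. universe A \<noteq> {} \<and>
     (\<forall>R \<in> symbols \<sigma>. rel A R \<subseteq> {xs. length xs = arity \<sigma> R \<and> set xs \<subseteq> universe A}) \<and>
     (\<forall>R. R \<notin> symbols \<sigma> \<longrightarrow> rel A R = {})}"

definition induced :: "('s, 'a) struct \<Rightarrow> 'a set \<Rightarrow> ('s, 'a) struct" where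
  "induced A u = \<lparr> universe = u, rel = (\<lambda>R. {xs \<in> rel A R. set xs \<subseteq> u}) \<rparr>"

definition hom :: "('s, 'a) struct \<Rightarrow> ('s, 'b) struct \<Rightarrow> ('a \<Rightarrow> 'b) \<Rightarrow> bool" where
  "hom A B h \<longleftrightarrow> h ` universe A \<subseteq> universe B \<and> (\<forall>R. \<forall>xs \<in> rel A R. map h xs \<in> rel B R)"

text \<open>Isomorphisms, embeddings, charts and partial isomorphisms are all partial maps whose
  \<open>dom\<close> is the exact domain. Equality and composition (\<open>\<circ>\<^sub>m\<close>) of such maps are therefore those
  of partial maps, and \<open>\<subseteq>\<^sub>m\<close> is extension.\<close>

definition iso :: "('s, 'a) struct \<Rightarrow> ('s, 'b) struct \<Rightarrow> ('a \<rightharpoonup> 'b) \<Rightarrow> bool" where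
  "iso A B f \<longleftrightarrow> dom f = universe A \<and> ran f = universe B \<and> inj_on f (dom f) \<and>
     (\<forall>R xs. set xs \<subseteq> universe A \<longrightarrow> (xs \<in> rel A R \<longleftrightarrow> map (\<lambda>x. the (f x)) xs \<in> rel B R))"

definition automorphism :: "('s, 'a) struct \<Rightarrow> ('a \<rightharpoonup> 'a) \<Rightarrow> bool" where
  "automorphism A f \<longleftrightarrow> iso A A f"

definition embedding :: "('s, 'a) struct \<Rightarrow> ('s, 'b) struct \<Rightarrow> ('a \<rightharpoonup> 'b) \<Rightarrow> bool" where
  "embedding A B e \<longleftrightarrow> ran e \<subseteq> universe B \<and> iso A (induced B (ran e)) e"

definition partial_iso :: "('s, 'a) struct \<Rightarrow> ('a \<rightharpoonup> 'a) \<Rightarrow> bool" where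
  "partial_iso A p \<longleftrightarrow> dom p \<subseteq> universe A \<and> ran p \<subseteq> universe A \<and>
     iso (induced A (dom p)) (induced A (ran p)) p"

text \<open>Meaningful for injective \<open>f\<close> only; \<open>dom (map_inv f) = ran f\<close>.\<close>

definition map_inv :: "('a \<rightharpoonup> 'b) \<Rightarrow> ('b \<rightharpoonup> 'a)" where
  "map_inv f = (\<lambda>y. if y \<in> ran f then Some (THE x. f x = Some y) else None)"

text \<open>A class of structures is rendered as a family of sets \<open>C\<close>, one for each type of elements.
  The structures of a class that enter one notion may live over different types.\<close>

definition fin :: "('s, 'a) struct set \<Rightarrow> ('s, 'a) struct set" where
  "fin C = {A \<in> C. finite (universe A)}"

definition ext_instance ::
  "('s, 'a) struct set \<Rightarrow> ('s, 'a) struct \<Rightarrow> ('a \<rightharpoonup> 'a) set \<Rightarrow> bool" where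
  "ext_instance C A\<^sub>0 P \<longleftrightarrow>
     A\<^sub>0 \<in> fin C \<and> (\<forall>p \<in> P. partial_iso A\<^sub>0 p) \<and> (\<forall>p \<in> P. map_inv p \<in> P)"

definition solutions ::
  "('s, 'b) struct set \<Rightarrow> ('s, 'a) struct \<Rightarrow> ('a \<rightharpoonup> 'a) set \<Rightarrow> ('s, 'b) struct set" where
  "solutions C A\<^sub>0 P = {A \<in> C. \<exists>e. embedding A\<^sub>0 A e \<and>
     (\<forall>p \<in> P. \<exists>f. automorphism A f \<and> e \<circ>\<^sub>m p \<circ>\<^sub>m map_inv e \<subseteq>\<^sub>m f)}"

text \<open>The three arguments are meant to be one and the same class over three types of elements:
  the type of the instance, that of the given (possibly infinite) solution, and \<open>nat\<close> for the
  finite solution, which suffices as every finite structure has an isomorphic copy over \<open>nat\<close>.\<close>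

definition EPPA ::
  "('s, 'a) struct set \<Rightarrow> ('s, 'b) struct set \<Rightarrow> ('s, nat) struct set \<Rightarrow> bool" where
  "EPPA C C' C'' \<longleftrightarrow> (\<forall>A\<^sub>0 P. ext_instance C A\<^sub>0 P \<longrightarrow>
     solutions C' A\<^sub>0 P \<noteq> {} \<longrightarrow> fin (solutions C'' A\<^sub>0 P) \<noteq> {})"

definition forbidden_structures :: "'s signature \<Rightarrow> ('s, 'x) struct set \<Rightarrow> bool" where
  "forbidden_structures \<sigma> X \<longleftrightarrow> finite X \<and> X \<subseteq> fin (Str \<sigma>)"

definition Forb :: "'s signature \<Rightarrow> ('s, 'x) struct set \<Rightarrow> ('s, 'a) struct set" where
  "Forb \<sigma> X = {A \<in> Str \<sigma>. \<forall>F \<in> X. \<nexists>h. hom F A h}"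

definition atlas ::
  "('s, 'a) struct \<Rightarrow> ('s, 'b) struct \<Rightarrow> ('b \<rightharpoonup> 'a) set \<Rightarrow> bool" where
  "atlas A\<^sub>0 A \<Pi> \<longleftrightarrow>
     (\<forall>\<pi> \<in> \<Pi>. dom \<pi> \<subseteq> universe A \<and> iso (induced A (dom \<pi>)) A\<^sub>0 \<pi>) \<and>
     (\<forall>a \<in> universe A. \<exists>\<pi> \<in> \<Pi>. a \<in> dom \<pi>) \<and>
     (\<forall>R. \<forall>xs \<in> rel A R. \<exists>\<pi> \<in> \<Pi>. set xs \<subseteq> dom \<pi>)"

definition chart_symmetries ::
  "('s, 'b) struct \<Rightarrow> ('b \<rightharpoonup> 'a) set \<Rightarrow> ('b \<rightharpoonup> 'b) set" where
  "chart_symmetries A \<Pi> =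
     {f. automorphism A f \<and> bij_betw (\<lambda>\<pi>. \<pi> \<circ>\<^sub>m map_inv f) \<Pi> \<Pi>}"

text \<open>\<open>comp_seq A\<^sub>0 [p\<^sub>1, \<dots>, p\<^sub>n]\<close> is the partial map \<open>p\<^sub>n \<circ> \<dots> \<circ> p\<^sub>1\<close> in \<open>A\<^sub>0\<close>.\<close>

fun comp_seq :: "('s, 'a) struct \<Rightarrow> ('a \<rightharpoonup> 'a) list \<Rightarrow> ('a \<rightharpoonup> 'a)" where
  "comp_seq A\<^sub>0 [] = Some |` universe A\<^sub>0"
| "comp_seq A\<^sub>0 (p # ps) = comp_seq A\<^sub>0 ps \<circ>\<^sub>m p"

definition fully_symmetric_solution ::
  "'s signature \<Rightarrow> ('s, 'a) struct \<Rightarrow> ('a \<rightharpoonup> 'a) set \<Rightarrow> ('s, 'b) struct \<Rightarrow> ('b \<rightharpoonup> 'a) set \<Rightarrow> bool" where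
  "fully_symmetric_solution \<sigma> A\<^sub>0 P A \<Pi> \<longleftrightarrow>
     A \<in> solutions (Str \<sigma>) A\<^sub>0 P \<and> atlas A\<^sub>0 A \<Pi> \<and>
     (\<forall>\<pi> \<in> \<Pi>. \<forall>\<pi>' \<in> \<Pi>. \<exists>f \<in> chart_symmetries A \<Pi>. \<pi> \<circ>\<^sub>m map_inv f = \<pi>') \<and>
     (\<forall>\<pi> \<in> \<Pi>. \<forall>\<pi>' \<in> \<Pi>. dom \<pi> \<inter> dom \<pi>' \<noteq> {} \<longrightarrow>
        (\<exists>ps. set ps \<subseteq> P \<and> \<pi>' \<circ>\<^sub>m map_inv \<pi> = comp_seq A\<^sub>0 ps))"

definition hypergraph :: "'b set \<Rightarrow> 'b set set \<Rightarrow> bool" where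
  "hypergraph V U \<longleftrightarrow> (\<forall>u \<in> U. finite u \<and> u \<noteq> {}) \<and> V = \<Union> U"

definition gaifman :: "'b set set \<Rightarrow> 'b \<Rightarrow> 'b \<Rightarrow> bool" where
  "gaifman U a a' \<longleftrightarrow> a \<noteq> a' \<and> (\<exists>u \<in> U. a \<in> u \<and> a' \<in> u)"

definition cycle :: "('b \<Rightarrow> 'b \<Rightarrow> bool) \<Rightarrow> 'b list \<Rightarrow> bool" where
  "cycle E xs \<longleftrightarrow> length xs \<ge> 3 \<and> distinct xs \<and>
     (\<forall>i < length xs. E (xs ! i) (xs ! (Suc i mod length xs)))"

definition chordless :: "('b \<Rightarrow> 'b \<Rightarrow> bool) \<Rightarrow> 'b list \<Rightarrow> bool" where
  "chordless E xs \<longleftrightarrow> (\<forall>i < length xs. \<forall>j < length xs. E (xs ! i) (xs ! j) \<longrightarrow>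
     j = Suc i mod length xs \<or> i = Suc j mod length xs)"

text \<open>Cliques are non-empty here: otherwise the hypergraph without vertices, which occurs among
  the induced sub-hypergraphs, would not be acyclic.\<close>

definition clique :: "('b \<Rightarrow> 'b \<Rightarrow> bool) \<Rightarrow> 'b set \<Rightarrow> bool" where
  "clique E K \<longleftrightarrow> K \<noteq> {} \<and> (\<forall>a \<in> K. \<forall>a' \<in> K. a \<noteq> a' \<longrightarrow> E a a')"

definition hg_acyclic :: "'b set \<Rightarrow> 'b set set \<Rightarrow> bool" where
  "hg_acyclic V U \<longleftrightarrow>
     (\<nexists>xs. set xs \<subseteq> V \<and> length xs > 3 \<and> cycle (gaifman U) xs \<and> chordless (gaifman U) xs) \<and>
     (\<forall>K \<subseteq> V. clique (gaifman U) K \<longrightarrow> (\<exists>u \<in> U. K \<subseteq> u))"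

definition induced_hyperedges :: "'b set set \<Rightarrow> 'b set \<Rightarrow> 'b set set" where
  "induced_hyperedges U S = {u \<inter> S | u. u \<in> U \<and> u \<inter> S \<noteq> {}}"

definition N_acyclic :: "nat \<Rightarrow> 'b set \<Rightarrow> 'b set set \<Rightarrow> bool" where
  "N_acyclic N V U \<longleftrightarrow> hypergraph V U \<and>
     (\<forall>S \<subseteq> V. finite S \<and> card S \<le> N \<longrightarrow> hg_acyclic S (induced_hyperedges U S))"

definition N_universal :: "nat \<Rightarrow> ('s, 'b) struct \<Rightarrow> ('s, 'c) struct set \<Rightarrow> bool" where
  "N_universal N A C \<longleftrightarrow>
     (\<forall>S \<subseteq> universe A. S \<noteq> {} \<and> finite S \<and> card S \<le> N \<longrightarrow>
        (\<forall>B \<in> C. \<exists>h. hom (induced A S) B h))"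

end

(* Part (a): an acyclic hypergraph has a vertex whose neighbours all share a hyperedge with it.
   Removing such vertices one at a time, a homomorphism into any solution is defined chart by
   chart. At each step the new vertex is placed by one chart, and the transition maps, being
   compositions of members of P, are realized by automorphisms of the target.

   EPPA (the Herwig-Lascar theorem): let the words over P and formal inverses act on copies of
   A_0, gluing a in the chart of w to p(a) in the chart of w p. A finite quotient G of the words
   gives a finite solution. Take a chain of quotients in which G_(k+1) records, in addition to
   G_k, the parity of the number of times a word traverses each edge of the Cayley graph of G_k.
   A closed path in G_(k+1) then projects to a closed path in G_k with zero flow mod 2. Hence a
   chordless cycle, or a clique not contained in a chart, that occurs in the quotient at level
   k + 2 becomes degenerate at level k. A configuration of at most N points can degenerate only
   boundedly often along the chain, so it projects unchanged through two successive levels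
   somewhere. There it is acyclic, and the gluing of part (a) maps it into the given solution. *)

theory Submission
  imports Defs
begin

text \<open>Part (a) starts from a finite N-acyclic solution, and EPPA is proved without
  constructing one. A homomorphism from a forbidden structure meets at most N points, so it suffices
  that each such configuration is acyclic at some level of the chain. That level may vary with the
  configuration, since the maps obtained for different configurations are never compared. To this
  end points are kept as pairs \<open>(a, w)\<close> of an element and a word, which make sense at
  all levels at once, and the groups appear as congruences on words.

  Parity acts through cuts: two words that are equal at level k + 1 share an edge of the boundary of
  every set of level-k charts that separates their ends. Each acyclicity argument plays two routes
  between the same charts against each other at such a shared edge.

  The chain begins with permutations of \<open>A\<^sub>0\<close> that extend the members of
  \<open>P\<close>, so that no chart ever identifies two of its own points. Its length
  \<open>2 * 2 ^ N + 2\<close> reflects that a configuration has at most \<open>2 ^ N\<close>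
  subsets and that each of them can lose its common chart only once.\<close>

section \<open>Simplicial vertices of chordal graphs\<close>

text \<open>A walk of minimal length: a repeated vertex, or an edge that leads forward past the next
  position, would give a shortcut.\<close>

lemma shortest_walk:
  assumes "q0 \<noteq> []" "hd q0 = a" "last q0 = b" "set q0 \<subseteq> Z" "successively E q0"
  obtains q where "q \<noteq> []" "hd q = a" "last q = b" "set q \<subseteq> Z" "successively E q" "distinct q"
    "\<forall>i j. i < j \<longrightarrow> j < length q \<longrightarrow> E (q ! i) (q ! j) \<longrightarrow> j = Suc i"
proof -
  define W where "W q \<longleftrightarrow> q \<noteq> [] \<and> hd q = a \<and> last q = b \<and> set q \<subseteq> Z \<and> successively E q" for q
  have "W q0" using assms by (simp add: W_def)
  then obtain q where q: "W q" and min: "\<And>q'. W q' \<Longrightarrow> length q \<le> length q'"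
    using ex_has_least_nat[of W q0 length] by blast
  have W: "q \<noteq> []" "hd q = a" "last q = b" "set q \<subseteq> Z" "successively E q"
    using q by (auto simp: W_def)
  have sub: "set (take i q @ drop j q) \<subseteq> Z" for i j
    using W(4) set_take_subset[of i q] set_drop_subset[of j q] by auto
  have succ: "successively E (take i q)" "successively E (drop j q)" for i j
    using W(5) append_take_drop_id[of i q] append_take_drop_id[of j q]
    by (metis successively_append_iff)+
  \<comment> \<open>Positions \<open>i\<close> to \<open>j - 1\<close> cannot be spliced out of a
    shortest walk. A chord is excluded by using this with \<open>Suc i\<close> in place of
    \<open>i\<close>, a repetition \<open>q ! i = q ! j\<close> by using it as it stands.\<close>
  have short: "j \<le> i"
    if "i \<le> j" "j < length q" "i > 0 \<or> q ! j = a" "i > 0 \<Longrightarrow> E (q ! (i - 1)) (q ! j)" for i j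
  proof -
    have "W (take i q @ drop j q)"
      unfolding W_def
    proof (intro conjI)
      show "hd (take i q @ drop j q) = a"
        using W that by (cases "i = 0") (auto simp: hd_drop_conv_nth hd_append)
      show "last (take i q @ drop j q) = b" using W that by simp
      show "successively E (take i q @ drop j q)"
        using succ that W(1)
        by (cases "i = 0") (auto simp: successively_append_iff hd_drop_conv_nth last_conv_nth min_def)
    qed (use that sub in auto)
    then have "length q \<le> length (take i q @ drop j q)" by (rule min)
    then show ?thesis using that by simp
  qed
  have E: "j = Suc i" if "i < j" "j < length q" "E (q ! i) (q ! j)" for i j
    using short[of "Suc i" j] that by simp
  have "q ! i \<noteq> q ! j" if ij: "i < j" "j < length q" for i j
  proof
    assume eq: "q ! i = q ! j"
    have "j \<le> i"
    proof (rule short)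
      show "i > 0 \<or> q ! j = a" using eq W(1,2) by (cases i) (auto simp: hd_conv_nth)
      show "E (q ! (i - 1)) (q ! j)" if "i > 0"
      proof -
        have "E (q ! (i - 1)) (q ! Suc (i - 1))"
          using W(5) that ij by (simp add: successively_conv_nth del: Suc_pred)
        then show ?thesis using that eq by simp
      qed
    qed (use ij in auto)
    then show False using ij by simp
  qed
  then have "distinct q" unfolding distinct_conv_nth by (metis linorder_neqE_nat)
  with W E show ?thesis by (intro that[of q]) auto
qed

lemma walk_of_rtranclp:
  assumes "(\<lambda>a b. E a b \<and> a \<in> Z \<and> b \<in> Z)\<^sup>*\<^sup>* x y" "x \<in> Z"
  obtains q where "q \<noteq> []" "hd q = x" "last q = y" "set q \<subseteq> Z" "successively E q"
  using assms(1)
proof (induction arbitrary: thesis rule: rtranclp_induct)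
  case base
  show ?case using assms(2) by (intro base[of "[x]"]) auto
next
  case (step y z)
  from step.IH obtain q where "q \<noteq> []" "hd q = x" "last q = y" "set q \<subseteq> Z" "successively E q" .
  with step.hyps show ?case
    by (intro step.prems[of "q @ [z]"]) (auto simp: successively_append_iff)
qed

text \<open>Dirac's argument for simplicial vertices. Let \<open>C\<close> be the component of
  \<open>y\<close> among the non-neighbours of \<open>x\<close>, and \<open>B\<close> the boundary
  of \<open>C\<close>. All of \<open>B\<close> is adjacent to \<open>x\<close>, and \<open>B\<close>
  is a clique. Induction applies to \<open>C \<union> B\<close>, which lacks \<open>x\<close>. A
  vertex of \<open>C\<close> has all its neighbours there, so if it is simplicial in
  \<open>C \<union> B\<close> it is simplicial in \<open>V\<close>. Prescribing a non-neighbour is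
  what steers the induction into \<open>C\<close>.\<close>

lemma chordal_simplicial_nonneighbour:
  assumes "finite V" "symp E" "irreflp E"
    and "\<nexists>xs. set xs \<subseteq> V \<and> length xs > 3 \<and> cycle E xs \<and> chordless E xs"
    and "x \<in> V" "y \<in> V" "y \<noteq> x" "\<not> E x y"
  shows "\<exists>z \<in> V. z \<noteq> x \<and> \<not> E x z \<and> clique E {v \<in> V. v = z \<or> E z v}"
  using assms
proof (induction "card V" arbitrary: V x y rule: less_induct)
  case less
  note fin = less.prems(1) and chordal = less.prems(4)
  have sym: "E b a" if "E a b" for a b using that \<open>symp E\<close> by (auto dest: sympD)
  have irr: "\<not> E a a" for a using \<open>irreflp E\<close> by (auto dest: irreflpD)
  define D where "D = {v \<in> V. v \<noteq> x \<and> \<not> E x v}"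
  define C where "C = {z. (\<lambda>a b. E a b \<and> a \<in> D \<and> b \<in> D)\<^sup>*\<^sup>* y z}"
  define B where "B = {v \<in> V - C. \<exists>c \<in> C. E c v}"
  have yD: "y \<in> D" and yC: "y \<in> C" using less.prems by (auto simp: D_def C_def)
  have CD: "C \<subseteq> D"
  proof
    fix z assume "z \<in> C"
    then have "(\<lambda>a b. E a b \<and> a \<in> D \<and> b \<in> D)\<^sup>*\<^sup>* y z" by (simp add: C_def)
    then show "z \<in> D" by induction (use yD in auto)
  qed
  have C_closed: "b \<in> C" if "a \<in> C" "b \<in> D" "E a b" for a b
    using that CD unfolding C_def by (auto intro: rtranclp.rtrancl_into_rtrancl)
  have B_x: "E x v" if v: "v \<in> B" for v
  proof (rule ccontr)
    assume "\<not> E x v"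
    obtain c where c: "c \<in> C" "E c v" using v by (auto simp: B_def)
    then have "v \<noteq> x" using CD sym by (auto simp: D_def)
    then have "v \<in> D" using that \<open>\<not> E x v\<close> by (auto simp: B_def D_def)
    then have "v \<in> C" using c C_closed by blast
    then show False using that by (simp add: B_def)
  qed
  have conn: "(\<lambda>a b. E a b \<and> a \<in> C \<and> b \<in> C)\<^sup>*\<^sup>* y z" if "z \<in> C" for z
  proof -
    have "(\<lambda>a b. E a b \<and> a \<in> D \<and> b \<in> D)\<^sup>*\<^sup>* y z" using that by (simp add: C_def)
    then show ?thesis
    proof induction
      case (step u v)
      then have "u \<in> C" "v \<in> C" by (auto simp: C_def intro: rtranclp.rtrancl_into_rtrancl)
      with step show ?case by (auto intro: rtranclp.rtrancl_into_rtrancl)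
    qed simp
  qed
  \<comment> \<open>Otherwise a shortest walk from \<open>a\<close> to \<open>b\<close> through
    \<open>C\<close>, closed up by \<open>x\<close>, is a chordless cycle, because \<open>x\<close>
    is adjacent to no vertex of \<open>C\<close>. It is longer than 3 since \<open>a\<close> and
    \<open>b\<close> are not adjacent.\<close>
  have B_clique: "E a b" if ab: "a \<in> B" "b \<in> B" "a \<noteq> b" for a b
  proof (rule ccontr)
    assume nE: "\<not> E a b"
    let ?Z = "insert a (insert b C)"
    let ?R = "\<lambda>u v. E u v \<and> u \<in> ?Z \<and> v \<in> ?Z"
    obtain c d where cd: "c \<in> C" "E c a" "d \<in> C" "E d b" using ab by (auto simp: B_def)
    have mono: "?R\<^sup>*\<^sup>* y z" if "z \<in> C" for z
      using conn[OF that] by (rule rtranclp_mono[THEN predicate2D, rotated]) auto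
    have "?R\<^sup>*\<^sup>* a y"
    proof -
      have "symp ?R\<^sup>*\<^sup>*" by (rule symp_rtranclp) (use sym in \<open>auto intro: sympI\<close>)
      moreover have "?R\<^sup>*\<^sup>* y a"
        using mono[OF cd(1)] by (rule rtranclp.rtrancl_into_rtrancl) (use cd in auto)
      ultimately show ?thesis by (auto dest: sympD)
    qed
    moreover have "?R\<^sup>*\<^sup>* y b"
      using mono[OF cd(3)] by (rule rtranclp.rtrancl_into_rtrancl) (use cd in auto)
    ultimately have "?R\<^sup>*\<^sup>* a b" by simp
    then obtain q0 where "q0 \<noteq> []" "hd q0 = a" "last q0 = b" "set q0 \<subseteq> ?Z" "successively E q0"
      using walk_of_rtranclp[of E ?Z a b] by blast
    then obtain q where q: "q \<noteq> []" "hd q = a" "last q = b" "set q \<subseteq> ?Z" "successively E q"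
        "distinct q" and ind: "\<forall>i j. i < j \<longrightarrow> j < length q \<longrightarrow> E (q ! i) (q ! j) \<longrightarrow> j = Suc i"
      by (rule shortest_walk)
    have ends: "q ! 0 = a" "q ! (length q - 1) = b"
      using q by (auto simp: hd_conv_nth last_conv_nth)
    have len: "length q \<ge> 3"
    proof (rule ccontr)
      assume "\<not> length q \<ge> 3"
      moreover have "length q \<noteq> 1" using ends ab by auto
      ultimately have "length q = 2" using q(1) by (cases "length q") auto
      then show False using ends nE q(5) by (auto simp: successively_conv_nth)
    qed
    let ?xs = "x # q"
    have xq: "x \<notin> set q" using q(4) B_x[OF ab(1)] B_x[OF ab(2)] irr CD by (auto simp: D_def)
    have inner: "i = 0 \<or> Suc i = length q" if "i < length q" "E x (q ! i)" for i
    proof -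
      have "q ! i \<notin> C" using that CD by (auto simp: D_def)
      then have "q ! i = a \<or> q ! i = b" using q(4) that by (auto dest: nth_mem)
      then have "q ! i = q ! 0 \<or> q ! i = q ! (length q - 1)" using ends by simp
      moreover have "0 < length q" "length q - 1 < length q" using len by linarith+
      ultimately have "i = 0 \<or> i = length q - 1"
        using q(6) that(1) by (metis nth_eq_iff_index_eq)
      then show ?thesis using len by linarith
    qed
    have "cycle E ?xs"
      unfolding cycle_def
    proof (intro conjI allI impI)
      fix i assume i: "i < length ?xs"
      show "E (?xs ! i) (?xs ! (Suc i mod length ?xs))"
      proof (cases i)
        case 0
        then show ?thesis using ends B_x[OF ab(1)] len q(1) by simp
      next
        case (Suc j)
        show ?thesis
        proof (cases "Suc j = length q")
          case True
          then have "q ! j = b" using ends(2) by (simp flip: True)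
          then have "?xs ! i = b" using Suc by simp
          moreover have "Suc i mod length ?xs = 0" using True Suc by simp
          ultimately show ?thesis using sym[OF B_x[OF ab(2)]] by simp
        next
          case False
          then show ?thesis using i Suc q(5) by (simp add: successively_conv_nth)
        qed
      qed
    qed (use len q xq in auto)
    moreover have "chordless E ?xs"
      unfolding chordless_def
    proof (intro allI impI)
      fix i j assume ij: "i < length ?xs" "j < length ?xs" and e: "E (?xs ! i) (?xs ! j)"
      show "j = Suc i mod length ?xs \<or> i = Suc j mod length ?xs"
      proof (cases i)
        case 0
        with e irr obtain j' where j: "j = Suc j'" by (cases j) auto
        then have "j' = 0 \<or> Suc j' = length q" using e ij 0 by (intro inner) auto
        then show ?thesis using 0 j q(1) by auto
      next
        case i: (Suc i')
        show ?thesis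
        proof (cases j)
          case 0
          then have "E x (q ! i')" using e i sym by simp
          then show ?thesis using inner[of i'] ij i 0 len by auto
        next
          case (Suc j')
          then have "i' < j' \<Longrightarrow> j' = Suc i'" "j' < i' \<Longrightarrow> i' = Suc j'" "i' \<noteq> j'"
            using e i ij ind sym irr by auto
          then have "i' < j' \<and> j' = Suc i' \<or> j' < i' \<and> i' = Suc j'" by linarith
          then show ?thesis using ij i Suc by auto
        qed
      qed
    qed
    moreover have "set ?xs \<subseteq> V" using q(4) less.prems ab CD by (auto simp: B_def D_def)
    ultimately show False using chordal len by (auto dest!: spec[of _ ?xs])
  qed
  let ?H = "C \<union> B"
  have HV: "?H \<subseteq> V" using CD by (auto simp: D_def B_def)
  have xH: "x \<notin> ?H" using CD B_x irr by (auto simp: D_def)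
  have lt: "card ?H < card V"
    using HV xH less.prems(5) by (intro psubset_card_mono[OF fin]) blast
  have lift: "clique E {v \<in> V. v = z \<or> E z v}" if "z \<in> C" "clique E {v \<in> ?H. v = z \<or> E z v}" for z
  proof -
    have "{v \<in> V. v = z \<or> E z v} = {v \<in> ?H. v = z \<or> E z v}"
      using that(1) HV by (auto simp: B_def)
    then show ?thesis using that(2) by simp
  qed
  have IH: "\<exists>z \<in> ?H. z \<noteq> u \<and> \<not> E u z \<and> clique E {v \<in> ?H. v = z \<or> E z v}"
    if "u \<in> ?H" "w \<in> ?H" "w \<noteq> u" "\<not> E u w" for u w
    by (rule less.hyps[OF lt, of u w]) (use that less.prems HV fin in \<open>auto intro: finite_subset\<close>)
  \<comment> \<open>The simplicial vertex has to avoid \<open>B\<close>. As a non-neighbour of the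
    chosen \<open>u\<close> it does so when \<open>u\<close> lies in the clique \<open>B\<close>,
    and also when every vertex of \<open>B\<close> is adjacent to all others. If no \<open>u\<close>
    has a non-neighbour, then \<open>C \<union> B\<close> is itself a clique and \<open>y\<close>
    serves.\<close>
  have "\<exists>z \<in> C. clique E {v \<in> ?H. v = z \<or> E z v}"
  proof (cases "\<exists>u \<in> B. \<exists>w \<in> ?H. w \<noteq> u \<and> \<not> E u w")
    case True
    then obtain u where u: "u \<in> B" "\<exists>w \<in> ?H. w \<noteq> u \<and> \<not> E u w" by blast
    then obtain z where "z \<in> ?H" "z \<noteq> u" "\<not> E u z" "clique E {v \<in> ?H. v = z \<or> E z v}"
      using IH[of u] by blast
    moreover have "z \<notin> B" using B_clique[of u z] u calculation by auto
    ultimately show ?thesis by blast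
  next
    case B: False
    show ?thesis
    proof (cases "\<exists>u \<in> C. \<exists>w \<in> ?H. w \<noteq> u \<and> \<not> E u w")
      case True
      then obtain u where u: "u \<in> C" "\<exists>w \<in> ?H. w \<noteq> u \<and> \<not> E u w" by blast
      then obtain z where "z \<in> ?H" "z \<noteq> u" "\<not> E u z" "clique E {v \<in> ?H. v = z \<or> E z v}"
        using IH[of u] by blast
      moreover have "z \<notin> B"
      proof
        assume "z \<in> B"
        then have "E z u" using B u(1) \<open>z \<noteq> u\<close> by (metis UnI1)
        then show False using \<open>\<not> E u z\<close> sym by blast
      qed
      ultimately show ?thesis by blast
    next
      case False
      have "E a b" if "a \<in> ?H" "b \<in> ?H" "a \<noteq> b" for a b
        using False B that by (metis Un_iff)
      then have "clique E {v \<in> ?H. v = y \<or> E y v}" using yC by (auto simp: clique_def)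
      then show ?thesis using yC by blast
    qed
  qed
  then obtain z where z: "z \<in> C" "clique E {v \<in> ?H. v = z \<or> E z v}" by blast
  have "z \<in> V" "z \<noteq> x" "\<not> E x z" using z(1) CD by (auto simp: D_def)
  then show ?case using lift[OF z] by blast
qed

text \<open>Chordality gives a vertex whose closed neighbourhood is a clique, and conformality puts
  this clique into one hyperedge.\<close>

lemma hg_acyclic_simplicial:
  assumes "finite V" "V \<noteq> {}" "hg_acyclic V U"
  obtains t u where "t \<in> V" "u \<in> U" "{v \<in> V. v = t \<or> gaifman U t v} \<subseteq> u"
proof -
  let ?E = "gaifman U"
  have "symp ?E" by (rule sympI) (auto simp: gaifman_def)
  have "irreflp ?E" by (rule irreflpI) (auto simp: gaifman_def)
  have chordal: "\<nexists>xs. set xs \<subseteq> V \<and> length xs > 3 \<and> cycle ?E xs \<and> chordless ?E xs"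
    by (rule assms(3)[unfolded hg_acyclic_def, THEN conjunct1])
  have "\<exists>z \<in> V. clique ?E {v \<in> V. v = z \<or> ?E z v}"
  proof (cases "\<exists>x \<in> V. \<exists>y \<in> V. y \<noteq> x \<and> \<not> ?E x y")
    case True
    then obtain x y where "x \<in> V" "y \<in> V" "y \<noteq> x" "\<not> ?E x y" by blast
    from chordal_simplicial_nonneighbour[OF assms(1) \<open>symp ?E\<close> \<open>irreflp ?E\<close> chordal this]
    show ?thesis by blast
  next
    case False
    obtain z where z: "z \<in> V" using assms(2) by blast
    have "?E a b" if "a \<in> V" "b \<in> V" "a \<noteq> b" for a b
      using False that by (metis (no_types))
    then have "clique ?E {v \<in> V. v = z \<or> ?E z v}" using z by (auto simp: clique_def)
    then show ?thesis using z by blast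
  qed
  then obtain z where z: "z \<in> V" and c: "clique ?E {v \<in> V. v = z \<or> ?E z v}" by blast
  have conformal: "\<exists>u \<in> U. K \<subseteq> u" if "K \<subseteq> V" "clique ?E K" for K
    by (rule assms(3)[unfolded hg_acyclic_def, THEN conjunct2, rule_format]) (fact that)+
  then obtain u where "u \<in> U" "{v \<in> V. v = z \<or> ?E z v} \<subseteq> u"
    using conformal[OF _ c] by blast
  with z show ?thesis by (intro that)
qed

section \<open>Gluing charts along an acyclic hypergraph\<close>

text \<open>Total functions with arbitrary values outside the universe, so that automorphisms
  compose by plain \<open>\<circ>\<close>; \<open>automorphism\<close> speaks of partial
  maps.\<close>

definition autos :: "('s, 'c) struct \<Rightarrow> ('c \<Rightarrow> 'c) set" where
  "autos B = {g. bij_betw g (universe B) (universe B) \<and>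
     (\<forall>R xs. set xs \<subseteq> universe B \<longrightarrow> (xs \<in> rel B R \<longleftrightarrow> map g xs \<in> rel B R))}"

lemma autos_into: "g \<in> autos B \<Longrightarrow> x \<in> universe B \<Longrightarrow> g x \<in> universe B"
  by (auto simp: autos_def bij_betw_def)

lemma id_autos: "id \<in> autos B"
  by (simp add: autos_def)

lemma comp_autos:
  assumes "f \<in> autos B" "g \<in> autos B"
  shows "f \<circ> g \<in> autos B"
proof -
  have "xs \<in> rel B R \<longleftrightarrow> map (f \<circ> g) xs \<in> rel B R" if "set xs \<subseteq> universe B" for xs R
  proof -
    have "set (map g xs) \<subseteq> universe B" using that autos_into[OF assms(2)] by auto
    then have "map g xs \<in> rel B R \<longleftrightarrow> map f (map g xs) \<in> rel B R"
      using assms(1) unfolding autos_def by blast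
    moreover have "xs \<in> rel B R \<longleftrightarrow> map g xs \<in> rel B R"
      using assms(2) that unfolding autos_def by blast
    ultimately show ?thesis by simp
  qed
  then show ?thesis using assms by (auto simp: autos_def intro: bij_betw_trans)
qed

lemma inv_autos:
  assumes "g \<in> autos B"
  obtains g' where "g' \<in> autos B" "\<And>x. x \<in> universe B \<Longrightarrow> g' (g x) = x"
proof -
  let ?g' = "inv_into (universe B) g"
  have bij: "bij_betw g (universe B) (universe B)" using assms by (simp add: autos_def)
  have bij': "bij_betw ?g' (universe B) (universe B)" using bij by (rule bij_betw_inv_into)
  have "xs \<in> rel B R \<longleftrightarrow> map ?g' xs \<in> rel B R" if xs: "set xs \<subseteq> universe B" for xs R
  proof -
    have "set (map ?g' xs) \<subseteq> universe B" using xs bij' by (auto simp: bij_betw_def)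
    then have "map ?g' xs \<in> rel B R \<longleftrightarrow> map g (map ?g' xs) \<in> rel B R"
      using assms unfolding autos_def by blast
    moreover have "map g (map ?g' xs) = xs"
      using xs bij by (auto simp: subset_iff bij_betw_inv_into_right intro!: map_idI)
    ultimately show ?thesis by simp
  qed
  then have "?g' \<in> autos B" using bij' by (simp add: autos_def)
  then show ?thesis using bij by (intro that[of ?g']) (auto simp: bij_betw_inv_into_left)
qed

lemma map_inv_eq_Some:
  assumes "inj_on f (dom f)" "f x = Some y"
  shows "map_inv f y = Some x"
proof -
  have "(THE x. f x = Some y) = x"
    using assms by (intro the_equality) (auto simp: inj_on_def dom_def)
  then show ?thesis using assms(2) by (auto simp: map_inv_def ran_def)
qed

text \<open>The data of a solution from which maps into it are built: a homomorphic image of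
  \<open>A\<^sub>0\<close> on which each member of \<open>P\<close> is induced by an automorphism of
  \<open>B\<close>.\<close>

definition realizes ::
  "('s, 'a) struct \<Rightarrow> ('a \<rightharpoonup> 'a) set \<Rightarrow> ('s, 'c) struct \<Rightarrow> ('a \<Rightarrow> 'c) \<Rightarrow> bool" where
  "realizes A\<^sub>0 P B \<epsilon> \<longleftrightarrow> \<epsilon> ` universe A\<^sub>0 \<subseteq> universe B \<and>
     (\<forall>R. \<forall>xs \<in> rel A\<^sub>0 R. map \<epsilon> xs \<in> rel B R) \<and>
     (\<forall>p \<in> P. \<exists>g \<in> autos B. \<forall>a b. p a = Some b \<longrightarrow> g (\<epsilon> a) = \<epsilon> b)"

lemma automorphism_autos:
  assumes "automorphism B f"
  shows "(\<lambda>x. the (f x)) \<in> autos B"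
proof -
  have f: "dom f = universe B" "ran f = universe B" "inj_on f (dom f)"
    using assms by (auto simp: automorphism_def iso_def)
  have "(\<lambda>x. the (f x)) ` universe B = universe B"
  proof -
    have "(\<lambda>x. the (f x)) ` dom f = ran f" by (force simp: ran_def dom_def image_iff)
    then show ?thesis using f by simp
  qed
  moreover have "inj_on (\<lambda>x. the (f x)) (universe B)"
    using f by (auto simp: inj_on_def dom_def set_eq_iff) (metis option.sel)
  ultimately show ?thesis
    using assms by (simp add: autos_def bij_betw_def automorphism_def iso_def)
qed

lemma solution_realizes:
  assumes "ext_instance C A\<^sub>0 P" "C \<subseteq> Str \<sigma>" "B \<in> solutions C' A\<^sub>0 P"
  obtains \<epsilon> where "realizes A\<^sub>0 P B \<epsilon>"
proof -
  obtain e where e: "embedding A\<^sub>0 B e"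
    and ext: "\<forall>p \<in> P. \<exists>f. automorphism B f \<and> e \<circ>\<^sub>m p \<circ>\<^sub>m map_inv e \<subseteq>\<^sub>m f"
    using assms(3) by (auto simp: solutions_def)
  let ?\<epsilon> = "\<lambda>x. the (e x)"
  have dom: "dom e = universe A\<^sub>0" and inj: "inj_on e (dom e)" and ran: "ran e \<subseteq> universe B"
    using e by (auto simp: embedding_def iso_def)
  have e_eq: "e a = Some (?\<epsilon> a)" if "a \<in> universe A\<^sub>0" for a
    using that by (simp flip: dom add: domIff)
  have A0: "A\<^sub>0 \<in> Str \<sigma>" using assms by (auto simp: ext_instance_def fin_def)
  have "?\<epsilon> ` universe A\<^sub>0 \<subseteq> universe B" using e_eq ran by (auto simp: ran_def)
  moreover have "map ?\<epsilon> xs \<in> rel B R" if "xs \<in> rel A\<^sub>0 R" for R xs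
  proof -
    have "set xs \<subseteq> universe A\<^sub>0"
      using A0 that by (cases "R \<in> symbols \<sigma>") (auto simp: Str_def)
    then have "map ?\<epsilon> xs \<in> rel (induced B (ran e)) R"
      using e that unfolding embedding_def iso_def by blast
    then show ?thesis by (simp add: induced_def)
  qed
  moreover have "\<exists>g \<in> autos B. \<forall>a b. p a = Some b \<longrightarrow> g (?\<epsilon> a) = ?\<epsilon> b" if p: "p \<in> P" for p
  proof -
    obtain f where f: "automorphism B f" "e \<circ>\<^sub>m p \<circ>\<^sub>m map_inv e \<subseteq>\<^sub>m f" using ext p by blast
    have "partial_iso A\<^sub>0 p" using assms(1) p by (simp add: ext_instance_def)
    then have sub: "dom p \<subseteq> universe A\<^sub>0" "ran p \<subseteq> universe A\<^sub>0" by (auto simp: partial_iso_def)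
    have "the (f (?\<epsilon> a)) = ?\<epsilon> b" if "p a = Some b" for a b
    proof -
      have a: "a \<in> universe A\<^sub>0" and b: "b \<in> universe A\<^sub>0" using that sub by (auto simp: ran_def)
      have "(e \<circ>\<^sub>m p \<circ>\<^sub>m map_inv e) (?\<epsilon> a) = Some (?\<epsilon> b)"
        using map_inv_eq_Some[OF inj e_eq[OF a]] that e_eq[OF b] by (simp add: map_comp_def)
      then show ?thesis using f(2) by (auto simp: map_le_def dom_def)
    qed
    then show ?thesis using automorphism_autos[OF f(1)] by (intro bexI[of _ "\<lambda>x. the (f x)"]) auto
  qed
  ultimately show ?thesis using that[of ?\<epsilon>] unfolding realizes_def by blast
qed

text \<open>The invariant is stronger than being a homomorphism: on each chart, \<open>h\<close> is
  \<open>\<epsilon>\<close> followed by an automorphism of \<open>B\<close>. A new vertex may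
  therefore be placed by any one chart that contains it together with its neighbours. The charts are
  bare coordinate maps \<open>pos j\<close>, since they stem from an atlas in part (a) and from
  words at some level in the proof of EPPA.\<close>

lemma glue_charts:
  fixes pos :: "'j \<Rightarrow> 'v \<rightharpoonup> 'a"
  assumes "finite S"
    and acyclic: "\<And>T. T \<subseteq> S \<Longrightarrow> hg_acyclic T (induced_hyperedges ((\<lambda>j. dom (pos j)) ` J) T)"
    and covered: "S \<subseteq> (\<Union>j \<in> J. dom (pos j))"
    and transition: "\<And>i j t. i \<in> J \<Longrightarrow> j \<in> J \<Longrightarrow> t \<in> S \<inter> dom (pos i) \<inter> dom (pos j) \<Longrightarrow>
      \<exists>g \<in> autos B. \<forall>x \<in> S. \<forall>a b. pos i x = Some a \<longrightarrow> pos j x = Some b \<longrightarrow> g (\<epsilon> a) = \<epsilon> b"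
    and into: "\<And>j x a. j \<in> J \<Longrightarrow> pos j x = Some a \<Longrightarrow> \<epsilon> a \<in> universe B"
  shows "\<exists>h. \<forall>j \<in> J. \<exists>g \<in> autos B. \<forall>x \<in> S. \<forall>a. pos j x = Some a \<longrightarrow> h x = g (\<epsilon> a)"
  using assms
proof (induction "card S" arbitrary: S rule: less_induct)
  case less
  show ?case
  proof (cases "S = {}")
    case True
    then show ?thesis using id_autos by auto
  next
    case False
    let ?U = "induced_hyperedges ((\<lambda>j. dom (pos j)) ` J) S"
    obtain t u where t: "t \<in> S" and u: "u \<in> ?U" and nbhd: "{v \<in> S. v = t \<or> gaifman ?U t v} \<subseteq> u"
      using hg_acyclic_simplicial[OF less.prems(1) False less.prems(2)[OF order_refl]] by blast
    obtain i where i: "i \<in> J" "u = dom (pos i) \<inter> S" using u by (auto simp: induced_hyperedges_def)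
    have ti: "t \<in> dom (pos i)" using nbhd t i(2) by auto
    \<comment> \<open>Points of \<open>S\<close> that share a chart with \<open>t\<close> are
      neighbours of \<open>t\<close> and hence belong to chart \<open>i\<close>.\<close>
    have in_i: "x \<in> dom (pos i)" if "j \<in> J" "t \<in> dom (pos j)" "x \<in> dom (pos j)" "x \<in> S" for j x
    proof -
      have "dom (pos j) \<inter> S \<in> ?U" using that by (auto simp: induced_hyperedges_def)
      moreover have "t \<in> dom (pos j) \<inter> S" "x \<in> dom (pos j) \<inter> S" using that t by auto
      ultimately have "x = t \<or> gaifman ?U t x" unfolding gaifman_def by metis
      then have "x \<in> u" using nbhd that(4) by blast
      then show ?thesis using i(2) by simp
    qed
    let ?S = "S - {t}"
    have "\<exists>h. \<forall>j \<in> J. \<exists>g \<in> autos B. \<forall>x \<in> ?S. \<forall>a. pos j x = Some a \<longrightarrow> h x = g (\<epsilon> a)"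
    proof (rule less.hyps)
      show "card ?S < card S" using t less.prems(1) by (meson card_Diff1_less)
      show "hg_acyclic T (induced_hyperedges ((\<lambda>j. dom (pos j)) ` J) T)" if "T \<subseteq> ?S" for T
        using less.prems(2) that by blast
      show "\<exists>g \<in> autos B. \<forall>x \<in> ?S. \<forall>a b. pos i x = Some a \<longrightarrow> pos j x = Some b \<longrightarrow> g (\<epsilon> a) = \<epsilon> b"
        if "i \<in> J" "j \<in> J" "s \<in> ?S \<inter> dom (pos i) \<inter> dom (pos j)" for i j s
        using less.prems(4)[of i j s] that by blast
    qed (use less.prems in auto)
    then obtain h where
      h: "\<forall>j \<in> J. \<exists>g \<in> autos B. \<forall>x \<in> ?S. \<forall>a. pos j x = Some a \<longrightarrow> h x = g (\<epsilon> a)" by blast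
    obtain g0 where g0: "g0 \<in> autos B" "\<forall>x \<in> ?S. \<forall>a. pos i x = Some a \<longrightarrow> h x = g0 (\<epsilon> a)"
      using h i(1) by blast
    let ?h = "h(t := g0 (\<epsilon> (the (pos i t))))"
    have hi: "?h x = g0 (\<epsilon> a)" if "x \<in> S" "pos i x = Some a" for x a
      using g0 that by auto
    have "\<exists>g \<in> autos B. \<forall>x \<in> S. \<forall>a. pos j x = Some a \<longrightarrow> ?h x = g (\<epsilon> a)" if j: "j \<in> J" for j
    proof (cases "t \<in> dom (pos j)")
      case True
      then obtain f where f: "f \<in> autos B"
        "\<forall>x \<in> S. \<forall>a b. pos j x = Some a \<longrightarrow> pos i x = Some b \<longrightarrow> f (\<epsilon> a) = \<epsilon> b"
        using less.prems(4)[of j i t] j i(1) t ti by blast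
      \<comment> \<open>A chart \<open>j\<close> through \<open>t\<close> lies, within
        \<open>S\<close>, inside chart \<open>i\<close>: the transition \<open>f\<close> passes to
        the coordinates of \<open>i\<close>, where \<open>g0\<close> describes the map.\<close>
      have "?h x = (g0 \<circ> f) (\<epsilon> a)" if x: "x \<in> S" "pos j x = Some a" for x a
      proof -
        obtain b where b: "pos i x = Some b" using in_i[OF j True _ x(1)] x(2) by blast
        then have "f (\<epsilon> a) = \<epsilon> b" using f(2) x by blast
        then show ?thesis using hi[OF x(1) b] by simp
      qed
      then show ?thesis using comp_autos[OF g0(1) f(1)] by blast
    next
      case False
      obtain g where g: "g \<in> autos B" "\<forall>x \<in> ?S. \<forall>a. pos j x = Some a \<longrightarrow> h x = g (\<epsilon> a)"
        using h j by blast
      have "?h x = g (\<epsilon> a)" if "x \<in> S" "pos j x = Some a" for x a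
        using g(2) that False by auto
      then show ?thesis using g(1) by blast
    qed
    then show ?thesis by blast
  qed
qed

lemma comp_seq_autos:
  assumes "realizes A\<^sub>0 P B \<epsilon>" "set ps \<subseteq> P"
  shows "\<exists>g \<in> autos B. \<forall>a b. comp_seq A\<^sub>0 ps a = Some b \<longrightarrow> g (\<epsilon> a) = \<epsilon> b"
  using assms(2)
proof (induction ps)
  case Nil
  then show ?case by (intro bexI[OF _ id_autos]) (auto simp: restrict_map_def split: if_splits)
next
  case (Cons p ps)
  then obtain g where g: "g \<in> autos B" "\<forall>a b. comp_seq A\<^sub>0 ps a = Some b \<longrightarrow> g (\<epsilon> a) = \<epsilon> b"
    by auto
  obtain f where f: "f \<in> autos B" "\<forall>a b. p a = Some b \<longrightarrow> f (\<epsilon> a) = \<epsilon> b"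
    using assms(1) Cons.prems by (auto simp: realizes_def)
  have "(g \<circ> f) (\<epsilon> a) = \<epsilon> b" if "comp_seq A\<^sub>0 (p # ps) a = Some b" for a b
    using that f(2) g(2) by (auto simp: map_comp_Some_iff)
  then show ?case using comp_autos[OF g(1) f(1)] by blast
qed

lemma glued_hom:
  assumes real: "realizes A\<^sub>0 P B \<epsilon>"
    and h: "\<forall>j \<in> J. \<exists>g \<in> autos B. \<forall>x \<in> S. \<forall>a. pos j x = Some a \<longrightarrow> h x = g (\<epsilon> a)"
    and j: "j \<in> J" and xs: "set xs \<subseteq> S" "list_all2 (\<lambda>x a. pos j x = Some a) xs as"
    and "as \<in> rel A\<^sub>0 R" "set as \<subseteq> universe A\<^sub>0"
  shows "map h xs \<in> rel B R"
proof -
  obtain g where g: "g \<in> autos B" "\<forall>x \<in> S. \<forall>a. pos j x = Some a \<longrightarrow> h x = g (\<epsilon> a)"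
    using h j by blast
  have "map h xs = map g (map \<epsilon> as)"
    using xs g(2) by (auto simp: list_all2_conv_all_nth subset_iff intro!: nth_equalityI)
  moreover have "map \<epsilon> as \<in> rel B R" "set (map \<epsilon> as) \<subseteq> universe B"
    using real assms(6,7) by (auto simp: realizes_def)
  ultimately show ?thesis using g(1) unfolding autos_def by auto
qed

section \<open>Universality of acyclic fully symmetric solutions\<close>

lemma N_universal_solutions:
  assumes inst: "ext_instance (Str \<sigma>) A\<^sub>0 P"
    and fs: "fully_symmetric_solution \<sigma> A\<^sub>0 P A \<Pi>"
    and ac: "N_acyclic N (universe A) (dom ` \<Pi>)"
  shows "N_universal N A (solutions (Str \<sigma>) A\<^sub>0 P)"
  unfolding N_universal_def
proof (intro allI impI ballI, elim conjE)
  fix S and B :: "('a, 'd) struct"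
  assume S: "S \<subseteq> universe A" "finite S" "card S \<le> N" and B: "B \<in> solutions (Str \<sigma>) A\<^sub>0 P"
  obtain \<epsilon> where real: "realizes A\<^sub>0 P B \<epsilon>"
    using solution_realizes[OF inst order_refl B] by blast
  have atlas: "atlas A\<^sub>0 A \<Pi>" using fs by (simp add: fully_symmetric_solution_def)
  have chart: "iso (induced A (dom \<pi>)) A\<^sub>0 \<pi>" if "\<pi> \<in> \<Pi>" for \<pi>
    using atlas that by (simp add: atlas_def)
  have chart_into: "a \<in> universe A\<^sub>0" if "\<pi> \<in> \<Pi>" "\<pi> x = Some a" for \<pi> x a
    using chart[OF that(1)] that(2) by (auto simp: iso_def ran_def)
  have cover: "S \<subseteq> (\<Union>\<pi> \<in> \<Pi>. dom \<pi>)" using atlas S(1) unfolding atlas_def by blast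
  have "\<exists>h. \<forall>\<pi> \<in> \<Pi>. \<exists>g \<in> autos B. \<forall>x \<in> S. \<forall>a. \<pi> x = Some a \<longrightarrow> h x = g (\<epsilon> a)"
  proof (rule glue_charts[OF S(2) _ cover])
    fix T assume "T \<subseteq> S"
    then have "T \<subseteq> universe A" "finite T" "card T \<le> N"
      using S finite_subset card_mono[OF S(2), of T] by auto
    then show "hg_acyclic T (induced_hyperedges (dom ` \<Pi>) T)"
      using ac by (simp add: N_acyclic_def)
  next
    fix \<pi> \<pi>' t assume \<pi>: "\<pi> \<in> \<Pi>" "\<pi>' \<in> \<Pi>" "t \<in> S \<inter> dom \<pi> \<inter> dom \<pi>'"
    then have "dom \<pi> \<inter> dom \<pi>' \<noteq> {}" by blast
    then obtain ps where ps: "set ps \<subseteq> P" "\<pi>' \<circ>\<^sub>m map_inv \<pi> = comp_seq A\<^sub>0 ps"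
      using fs \<pi>(1,2) unfolding fully_symmetric_solution_def by metis
    obtain g where g: "g \<in> autos B" "\<forall>a b. comp_seq A\<^sub>0 ps a = Some b \<longrightarrow> g (\<epsilon> a) = \<epsilon> b"
      using comp_seq_autos[OF real ps(1)] by blast
    have inj: "inj_on \<pi> (dom \<pi>)" using chart[OF \<pi>(1)] by (simp add: iso_def)
    have "g (\<epsilon> a) = \<epsilon> b" if "\<pi> x = Some a" "\<pi>' x = Some b" for x a b
    proof -
      have "(\<pi>' \<circ>\<^sub>m map_inv \<pi>) a = Some b"
        using map_inv_eq_Some[OF inj that(1)] that(2) by simp
      then show ?thesis using g(2) ps(2) by simp
    qed
    then show "\<exists>g \<in> autos B. \<forall>x \<in> S. \<forall>a b. \<pi> x = Some a \<longrightarrow> \<pi>' x = Some b \<longrightarrow> g (\<epsilon> a) = \<epsilon> b"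
      using g(1) by blast
  next
    fix \<pi> x a assume "\<pi> \<in> \<Pi>" "\<pi> x = Some a"
    then show "\<epsilon> a \<in> universe B" using chart_into real by (auto simp: realizes_def)
  qed
  then obtain h where h: "\<forall>\<pi> \<in> \<Pi>. \<exists>g \<in> autos B. \<forall>x \<in> S. \<forall>a. \<pi> x = Some a \<longrightarrow> h x = g (\<epsilon> a)"
    by blast
  have "h x \<in> universe B" if x: "x \<in> S" for x
  proof -
    obtain \<pi> a where \<pi>: "\<pi> \<in> \<Pi>" "\<pi> x = Some a" using cover x by blast
    then obtain g where "g \<in> autos B" "h x = g (\<epsilon> a)" using h x by blast
    moreover have "\<epsilon> a \<in> universe B" using chart_into[OF \<pi>] real by (auto simp: realizes_def)
    ultimately show ?thesis by (simp add: autos_into)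
  qed
  moreover have "map h xs \<in> rel B R" if xs: "xs \<in> rel (induced A S) R" for R xs
  proof -
    have xs': "xs \<in> rel A R" "set xs \<subseteq> S" using xs by (auto simp: induced_def)
    then obtain \<pi> where \<pi>: "\<pi> \<in> \<Pi>" "set xs \<subseteq> dom \<pi>" using atlas unfolding atlas_def by metis
    let ?as = "map (\<lambda>x. the (\<pi> x)) xs"
    have "xs \<in> rel (induced A (dom \<pi>)) R" using xs' \<pi>(2) by (simp add: induced_def)
    then have "?as \<in> rel A\<^sub>0 R"
      using chart[OF \<pi>(1)] \<pi>(2) unfolding iso_def by (auto simp: induced_def)
    moreover have "list_all2 (\<lambda>x a. \<pi> x = Some a) xs ?as"
      using \<pi>(2) by (auto simp: list_all2_conv_all_nth subset_iff domIff dest!: nth_mem)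
    moreover have "set ?as \<subseteq> universe A\<^sub>0" using \<pi> chart_into[OF \<pi>(1)] by fastforce
    ultimately show ?thesis using glued_hom[OF real h \<pi>(1) xs'(2)] by blast
  qed
  ultimately show "\<exists>h. hom (induced A S) B h"
    by (intro exI[of _ h]) (auto simp: hom_def induced_def)
qed

lemma Forb_subset_Str: "Forb \<sigma> X \<subseteq> Str \<sigma>"
  by (auto simp: Forb_def)

lemma solutions_mono: "C \<subseteq> C' \<Longrightarrow> solutions C A\<^sub>0 P \<subseteq> solutions C' A\<^sub>0 P"
  by (auto simp: solutions_def)

lemma Str_tuple:
  assumes "A \<in> Str \<sigma>" "xs \<in> rel A R"
  shows "set xs \<subseteq> universe A"
  using assms by (cases "R \<in> symbols \<sigma>") (auto simp: Str_def)

text \<open>The image of a forbidden structure in \<open>A\<close> has at most \<open>N\<close>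
  points, and a homomorphism from this image to \<open>B\<close> would carry the forbidden structure
  on into \<open>B\<close>.\<close>

lemma N_universal_Forb:
  assumes "N_universal N A C" "A \<in> Str \<sigma>" "forbidden_structures \<sigma> X"
    and "\<forall>F \<in> X. card (universe F) \<le> N" "B \<in> C" "B \<in> Forb \<sigma> X"
  shows "A \<in> Forb \<sigma> X"
proof -
  have "\<not> hom F A h" if F: "F \<in> X" for F h
  proof
    assume h: "hom F A h"
    let ?S = "h ` universe F"
    have F': "F \<in> Str \<sigma>" "finite (universe F)"
      using assms(3) F by (auto simp: forbidden_structures_def fin_def)
    then have "universe F \<noteq> {}" by (simp add: Str_def)
    have "?S \<subseteq> universe A" "?S \<noteq> {}" "finite ?S"
      using h F' \<open>universe F \<noteq> {}\<close> by (auto simp: hom_def)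
    moreover have "card ?S \<le> N" using card_image_le[OF F'(2), of h] assms(4) F by fastforce
    ultimately obtain k where "hom (induced A ?S) B k"
      using assms(1,5) unfolding N_universal_def by blast
    moreover have "hom F (induced A ?S) h"
      using h Str_tuple[OF F'(1)] by (fastforce simp: hom_def induced_def)
    ultimately have "hom F B (k \<circ> h)" by (fastforce simp: hom_def simp flip: map_map)
    then show False using assms(6) F by (auto simp: Forb_def)
  qed
  then show ?thesis using assms(2) by (auto simp: Forb_def)
qed

section \<open>Congruences on words\<close>

text \<open>The flag of a letter is \<open>False\<close> for a formal inverse.\<close>

type_synonym 'l word = "('l \<times> bool) list"

definition flip :: "'l \<times> bool \<Rightarrow> 'l \<times> bool" where
  "flip x = (fst x, \<not> snd x)"

definition winv :: "'l word \<Rightarrow> 'l word" where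
  "winv w = rev (map flip w)"

lemma flip_flip [simp]: "flip (flip x) = x"
  by (simp add: flip_def)

lemma winv_winv [simp]: "winv (winv w) = w"
  by (simp add: winv_def rev_map comp_def)

lemma winv_simps: "winv [] = []" "winv (x # w) = winv w @ [flip x]"
  by (auto simp: winv_def)

text \<open>The edges of the Cayley graph traversed by the word \<open>w\<close> from the vertex \<open>v\<close>. The pair
  \<open>(v, l)\<close> stands for the edge from \<open>v\<close> to \<open>v l\<close>, which the letter \<open>(l, False)\<close> passes backwards.\<close>

primrec edges :: "'l word \<Rightarrow> 'l word \<Rightarrow> ('l word \<times> 'l) list" where
  "edges v [] = []"
| "edges v (x # w) = (if snd x then v else v @ [x], fst x) # edges (v @ [x]) w"

lemma edges_append: "edges v (u @ w) = edges v u @ edges (v @ u) w"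
  by (induction u arbitrary: v) auto

lemma edges_shift: "edges (w @ v) u = map (\<lambda>(y, l). (w @ y, l)) (edges v u)"
proof (induction u arbitrary: v)
  case (Cons x u)
  show ?case using Cons[of "v @ [x]"] by simp
qed simp

lemma edges_in_lists:
  "v \<in> lists (L \<times> UNIV) \<Longrightarrow> u \<in> lists (L \<times> UNIV) \<Longrightarrow> set (edges v u) \<subseteq> lists (L \<times> UNIV) \<times> L"
proof (induction u arbitrary: v)
  case (Cons x u)
  then have "v @ [x] \<in> lists (L \<times> UNIV)" by auto
  with Cons show ?case by (auto dest: Cons.IH[THEN subsetD, rotated 2])
qed simp

text \<open>These congruences are the quotients of the free group on the letters: inverses are given
  by \<open>flip\<close>, and cancellation is required only modulo \<open>E\<close>. Using relations
  on words lets one word name an element of every group in the chain.\<close>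

definition word_cong :: "('l word \<Rightarrow> 'l word \<Rightarrow> bool) \<Rightarrow> bool" where
  "word_cong E \<longleftrightarrow> equivp E \<and> (\<forall>u v w. E u v \<longrightarrow> E (w @ u) (w @ v) \<and> E (u @ w) (v @ w)) \<and>
     (\<forall>x. E [x, flip x] [])"

context
  fixes E :: "'l word \<Rightarrow> 'l word \<Rightarrow> bool"
  assumes cong: "word_cong E"
begin

lemma word_cong_refl: "E u u"
  and word_cong_sym: "E u v \<Longrightarrow> E v u"
  and word_cong_trans: "E u v \<Longrightarrow> E v w \<Longrightarrow> E u w"
  using cong unfolding word_cong_def by (blast dest: equivp_reflp equivp_symp equivp_transp)+

lemma word_cong_left: "E u v \<Longrightarrow> E (w @ u) (w @ v)"
  and word_cong_right: "E u v \<Longrightarrow> E (u @ w) (v @ w)"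
  and word_cong_flip: "E [x, flip x] []"
  using cong unfolding word_cong_def by blast+

lemma word_cong_winv: "E (w @ winv w) []"
proof (induction w)
  case (Cons x w)
  have "E ([x] @ (w @ winv w) @ [flip x]) ([x] @ [] @ [flip x])"
    by (intro word_cong_left word_cong_right Cons)
  then have "E ((x # w) @ winv (x # w)) [x, flip x]" by (simp add: winv_simps)
  then show ?case using word_cong_flip by (rule word_cong_trans)
qed (simp add: winv_simps word_cong_refl)

lemma word_cong_winv': "E (winv w @ w) []"
  using word_cong_winv[of "winv w"] by simp

lemma word_cong_append_iff: "E (w @ u) v \<longleftrightarrow> E u (winv w @ v)"
proof
  assume "E (w @ u) v"
  then have "E (winv w @ w @ u) (winv w @ v)" by (rule word_cong_left)
  moreover have "E ((winv w @ w) @ u) ([] @ u)" by (intro word_cong_right word_cong_winv')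
  ultimately show "E u (winv w @ v)" by (auto intro: word_cong_sym word_cong_trans)
next
  assume "E u (winv w @ v)"
  then have "E (w @ u) (w @ winv w @ v)" by (rule word_cong_left)
  moreover have "E ((w @ winv w) @ v) ([] @ v)" by (intro word_cong_right word_cong_winv)
  ultimately show "E (w @ u) v" by (auto intro: word_cong_trans)
qed

lemma word_cong_cancel: "E (w @ u) (w @ v) \<longleftrightarrow> E u v"
proof
  assume "E (w @ u) (w @ v)"
  then have "E u ((winv w @ w) @ v)" by (simp add: word_cong_append_iff)
  moreover have "E ((winv w @ w) @ v) ([] @ v)" by (intro word_cong_right word_cong_winv')
  ultimately show "E u v" by (auto intro: word_cong_trans)
qed (rule word_cong_left)

lemma word_cong_eq: "E u v \<Longrightarrow> E u = E v"
  by (auto intro: word_cong_sym word_cong_trans)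

lemma word_cong_eq': "E u v \<Longrightarrow> E w u \<longleftrightarrow> E w v"
  by (auto intro: word_cong_sym word_cong_trans)

end

lemma edges_base_cong:
  assumes "word_cong E" "E v v'" "(y, l) \<in> set (edges v u)"
  shows "\<exists>y'. (y', l) \<in> set (edges v' u) \<and> E y y'"
proof -
  obtain w where w: "(w, l) \<in> set (edges [] u)" "y = v @ w"
    using assms(3) edges_shift[of v "[]" u] by auto
  then have "(v' @ w, l) \<in> set (edges v' u)" using edges_shift[of v' "[]" u] by force
  moreover have "E y (v' @ w)" using word_cong_right[OF assms(1,2)] w(2) by simp
  ultimately show ?thesis by blast
qed

section \<open>Parity refinement of a congruence\<close>

definition visits :: "('l word \<Rightarrow> 'l word \<Rightarrow> bool) \<Rightarrow> 'l word \<times> 'l \<Rightarrow> 'l word \<Rightarrow> 'l word \<Rightarrow> nat" where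
  "visits E e v u = length (filter (\<lambda>(y, l). l = snd e \<and> E (fst e) y) (edges v u))"

text \<open>In group terms: the extension of the quotient by the space of 1-chains of its
  Cayley graph over the two-element field.\<close>

definition refine :: "('l word \<Rightarrow> 'l word \<Rightarrow> bool) \<Rightarrow> 'l word \<Rightarrow> 'l word \<Rightarrow> bool" where
  "refine E u v \<longleftrightarrow> E u v \<and> (\<forall>e. even (visits E e [] u) = even (visits E e [] v))"

lemma visits_append: "visits E e v (u @ w) = visits E e v u + visits E e (v @ u) w"
  by (simp add: visits_def edges_append)

lemma visits_shift:
  assumes "word_cong E"
  shows "visits E (x, l) v u = visits E (winv v @ x, l) [] u"
proof -
  have "E x (v @ y) \<longleftrightarrow> E (winv v @ x) y" for y
    using word_cong_append_iff[OF assms, of v y x] word_cong_sym[OF assms] by blast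
  then show ?thesis
    using edges_shift[of v "[]" u]
    by (simp add: visits_def filter_map comp_def case_prod_unfold)
qed

lemma visits_base_cong:
  assumes "word_cong E" "E v v'"
  shows "visits E e v u = visits E e v' u"
proof -
  have "E x (v @ y) \<longleftrightarrow> E x (v' @ y)" for x y
    using word_cong_eq'[OF assms(1) word_cong_right[OF assms]] .
  then show ?thesis
    using edges_shift[of v "[]" u] edges_shift[of v' "[]" u]
    by (simp add: visits_def filter_map comp_def case_prod_unfold)
qed

lemma refine_even_visits:
  assumes "word_cong E" "refine E u u'"
  shows "even (visits E e v u) = even (visits E e v u')"
  using assms visits_shift[OF assms(1), of "fst e" "snd e" v]
  by (simp add: refine_def)

text \<open>Left multiplication permutes the edges of the Cayley graph, so parities are compared
  after a translation. On the right, congruent words end at the same vertex, from which a further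
  word visits the same edges. A letter followed by its inverse passes one edge twice, which is
  invisible modulo 2.\<close>

lemma word_cong_refine:
  assumes E: "word_cong E"
  shows "word_cong (refine E)"
  unfolding word_cong_def
proof (intro conjI allI impI)
  show "equivp (refine E)"
  proof (intro equivpI reflpI sympI transpI)
    show "refine E u u" for u by (simp add: refine_def word_cong_refl[OF E])
    show "refine E v u" if "refine E u v" for u v
      using that word_cong_sym[OF E, of u v] by (simp add: refine_def)
    show "refine E u w" if "refine E u v" "refine E v w" for u v w
      using that word_cong_trans[OF E, of u v w] by (simp add: refine_def)
  qed
next
  fix u v w assume uv: "refine E u v"
  then have "E u v" by (simp add: refine_def)
  show "refine E (w @ u) (w @ v)"
    using word_cong_left[OF E \<open>E u v\<close>] refine_even_visits[OF E uv]
    by (simp add: refine_def visits_append)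
  show "refine E (u @ w) (v @ w)"
    using uv word_cong_right[OF E \<open>E u v\<close>] visits_base_cong[OF E \<open>E u v\<close>]
    by (simp add: refine_def visits_append)
next
  fix x
  have "even (visits E e [] [x, flip x])" for e
  proof -
    have "E (fst e) [x, flip x] \<longleftrightarrow> E (fst e) []"
      by (rule word_cong_eq'[OF E word_cong_flip[OF E]])
    then show ?thesis by (auto simp: visits_def flip_def)
  qed
  then show "refine E [x, flip x] []"
    using word_cong_flip[OF E] by (simp add: refine_def visits_def)
qed

text \<open>\<open>B\<close> is a union of classes of \<open>R\<close>, and a sum of even class
  counts would be even. The induction discards one evenly counted class at a time.\<close>

lemma odd_class:
  assumes "equivp R" "\<And>e e'. R e e' \<Longrightarrow> B e = B e'" "odd (length (filter B es))"
  shows "\<exists>e \<in> set es. B e \<and> odd (length (filter (R e) es))"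
  using assms(3)
proof (induction "length es" arbitrary: es rule: less_induct)
  case less
  have refl: "R e e" for e using assms(1) by (rule equivp_reflp)
  from less.prems have "filter B es \<noteq> []" by auto
  then obtain e where e: "e \<in> set es" "B e" by (auto simp: filter_empty_conv)
  show ?case
  proof (cases "odd (length (filter (R e) es))")
    case True
    with e show ?thesis by blast
  next
    case False
    let ?es = "filter (\<lambda>x. \<not> R e x) es"
    have "filter B (filter (R e) es) = filter (R e) es"
      using assms(2) e(2) by (auto intro!: filter_cong)
    moreover have "length (filter B es) = length (filter B (filter (R e) es)) + length (filter B ?es)"
      by (induction es) auto
    ultimately have "odd (length (filter B ?es))" using less.prems False by simp
    moreover have "length ?es < length es" using e refl by (intro length_filter_less) auto
    ultimately obtain e' where e': "e' \<in> set ?es" "B e'" "odd (length (filter (R e') ?es))"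
      using less.hyps by blast
    have "\<not> R e' x \<or> \<not> R e x" for x
      using e'(1) assms(1) by (auto dest: equivp_symp equivp_transp)
    then have "filter (R e') ?es = filter (R e') es" by (auto intro!: filter_cong)
    with e' show ?thesis by auto
  qed
qed

text \<open>A walk changes sides of the cut \<open>Q\<close> exactly at the edges counted
  here.\<close>

lemma odd_crossings:
  fixes Q :: "'l word \<Rightarrow> bool"
  assumes E: "word_cong E" and Q: "\<And>x y. E x y \<Longrightarrow> Q x = Q y"
  shows "odd (length (filter (\<lambda>(x, l). Q x \<noteq> Q (x @ [(l, True)])) (edges v u))) \<longleftrightarrow> Q v \<noteq> Q (v @ u)"
proof (induction u arbitrary: v)
  case (Cons x u)
  obtain l b where x: "x = (l, b)" by (cases x)
  \<comment> \<open>The edge of an inverse letter is recorded at its far end. Following it forward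
    from there returns to \<open>v\<close> only modulo \<open>E\<close>, which \<open>Q\<close>
    respects.\<close>
  have "Q (v @ [(l, False), (l, True)]) = Q v"
    using Q[OF word_cong_left[OF E word_cong_flip[OF E, of "(l, False)"]], of v]
    by (simp add: flip_def)
  show ?case
    by (cases b; cases "Q v"; cases "Q (v @ [x])"; cases "Q (v @ x # u)")
      (use Cons[of "v @ [x]"] x \<open>Q (v @ [(l, False), (l, True)]) = Q v\<close> in auto)
qed simp

text \<open>Two paths with the same end points modulo \<open>refine E\<close> agree in the parity of visits to each
  edge, so they share an edge of every cut that separates the end points.\<close>

lemma cut_edge:
  fixes Q :: "'l word \<Rightarrow> bool"
  assumes E: "word_cong E" and Q: "\<And>x y. E x y \<Longrightarrow> Q x = Q y" and "Q v" "\<not> Q (v @ u)"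
  obtains x l where "Q x \<noteq> Q (x @ [(l, True)])"
    "\<And>u'. refine E u u' \<Longrightarrow> \<exists>y. (y, l) \<in> set (edges v u') \<and> E x y"
proof -
  let ?R = "\<lambda>e e'. snd e' = snd e \<and> E (fst e) (fst e')"
  let ?B = "\<lambda>(x, l). Q x \<noteq> Q (x @ [(l, True)])"
  have "equivp ?R"
  proof (intro equivpI reflpI sympI transpI)
    show "?R e e" for e by (simp add: word_cong_refl[OF E])
    show "?R e' e" if "?R e e'" for e e'
      using that word_cong_sym[OF E, of "fst e" "fst e'"] by simp
    show "?R e e''" if "?R e e'" "?R e' e''" for e e' e''
      using that word_cong_trans[OF E, of "fst e" "fst e'" "fst e''"] by simp
  qed
  moreover have "?B e = ?B e'" if "?R e e'" for e e' :: "'l word \<times> 'l"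
  proof -
    have "Q (fst e) = Q (fst e')" using that by (intro Q) simp
    moreover have "Q (fst e @ [(snd e, True)]) = Q (fst e' @ [(snd e, True)])"
      using that by (intro Q word_cong_right[OF E]) simp
    ultimately show ?thesis using that by (simp add: case_prod_unfold)
  qed
  moreover have "odd (length (filter ?B (edges v u)))"
    using odd_crossings[OF E, of Q v u] Q assms(3,4) by simp
  \<comment> \<open>A boundary edge visited an odd number of times by \<open>u\<close>, hence by
    every word equal to \<open>u\<close> modulo \<open>refine E\<close>, and so at least
    once.\<close>
  ultimately obtain e where e: "?B e" "odd (length (filter (?R e) (edges v u)))"
    using odd_class[of ?R ?B] by blast
  have "\<exists>y. (y, snd e) \<in> set (edges v u') \<and> E (fst e) y" if "refine E u u'" for u'
  proof -
    have "odd (visits E e v u)" using e(2) by (simp add: visits_def case_prod_unfold)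
    then have "odd (visits E e v u')" using refine_even_visits[OF E that] by simp
    then have "filter (\<lambda>(y, l). l = snd e \<and> E (fst e) y) (edges v u') \<noteq> []"
      by (auto simp: visits_def)
    then show ?thesis by (auto simp: filter_empty_conv)
  qed
  with e(1) show ?thesis by (intro that[of "fst e" "snd e"]) (auto simp: case_prod_unfold)
qed

lemma finite_image_factor:
  assumes "finite (g ` W)" "\<And>w w'. w \<in> W \<Longrightarrow> w' \<in> W \<Longrightarrow> g w = g w' \<Longrightarrow> h w = h w'"
  shows "finite (h ` W)"
proof -
  have "h w = h (inv_into W g (g w))" if "w \<in> W" for w
    using that by (intro assms(2)) (auto simp: inv_into_into f_inv_into_f)
  then have "h ` W \<subseteq> (h \<circ> inv_into W g) ` g ` W" by auto
  then show ?thesis using assms(1) finite_subset by blast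
qed

text \<open>Modulo \<open>refine E\<close> a word is determined by its class modulo \<open>E\<close>
  and the set of edges that it visits an odd number of times. For words over \<open>L\<close> these
  edges come from the finitely many pairs of a class and a letter in \<open>L\<close>; this record
  is the map \<open>?g\<close>.\<close>

lemma finite_refine:
  assumes E: "word_cong E" and "finite L" and fin: "finite (E ` lists (L \<times> UNIV))"
  shows "finite (refine E ` lists (L \<times> UNIV))"
proof -
  let ?W = "lists (L \<times> UNIV)"
  let ?g = "\<lambda>w. (E w, {(E x, l) | x l. x \<in> ?W \<and> l \<in> L \<and> odd (visits E (x, l) [] w)})"
  have "?g ` ?W \<subseteq> E ` ?W \<times> Pow (E ` ?W \<times> L)" by auto
  moreover have "finite (E ` ?W \<times> Pow (E ` ?W \<times> L))"
    using assms by (intro finite_cartesian_product) simp_all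
  ultimately have "finite (?g ` ?W)" by (rule finite_subset)
  then show ?thesis
  proof (rule finite_image_factor)
    fix w w' assume w: "w \<in> ?W" "w' \<in> ?W" and eq: "?g w = ?g w'"
    have odd: "odd (visits E e [] w2)"
      if "w1 \<in> ?W" "?g w1 = ?g w2" "odd (visits E e [] w1)" for w1 w2 e
    proof -
      from that(3) have "filter (\<lambda>(y, l). l = snd e \<and> E (fst e) y) (edges [] w1) \<noteq> []"
        by (auto simp: visits_def)
      then obtain y where y: "(y, snd e) \<in> set (edges [] w1)" "E (fst e) y"
        by (auto simp: filter_empty_conv)
      have cls: "visits E (y', snd e) = visits E e" if "E y = E y'" for y'
      proof -
        have "E (fst e) = E y'" using word_cong_eq[OF E y(2)] that by simp
        then show ?thesis by (intro ext) (simp add: visits_def)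
      qed
      have "y \<in> ?W" "snd e \<in> L" using edges_in_lists[of "[]" L w1] that(1) y(1) by auto
      then have "(E y, snd e) \<in> snd (?g w1)" using that(3) cls[of y] by auto
      then have "(E y, snd e) \<in> snd (?g w2)" using that(2) by simp
      then obtain y' where "E y = E y'" "odd (visits E (y', snd e) [] w2)" by auto
      then show ?thesis using cls by simp
    qed
    have "E w w'" using eq word_cong_refl[OF E] by simp
    moreover have "even (visits E e [] w) = even (visits E e [] w')" for e
      using odd[OF w(1) eq, of e] odd[OF w(2) eq[symmetric], of e] by blast
    ultimately have "refine E w w'" by (simp add: refine_def)
    then show "refine E w = refine E w'" by (rule word_cong_eq[OF word_cong_refine[OF E]])
  qed
qed

section \<open>Points and charts of the quotients\<close>

text \<open>The partial maps \<open>act l\<close> define the gluing. Their extensions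
  \<open>perm l\<close> make every word act on all of \<open>A\<close>, which provides the finite
  group that the chain starts from.\<close>

locale partial_perms =
  fixes A :: "'a set" and act :: "'l \<Rightarrow> 'a \<rightharpoonup> 'a" and perm :: "'l \<Rightarrow> 'a \<Rightarrow> 'a"
  assumes finite_A: "finite A"
    and perm_bij: "bij_betw (perm l) A A"
    and act_dom: "act l a = Some b \<Longrightarrow> a \<in> A"
    and act_perm: "act l a = Some b \<Longrightarrow> perm l a = b"
begin

definition step :: "'l \<times> bool \<Rightarrow> 'a \<rightharpoonup> 'a" where
  "step x = (if snd x then act (fst x) else map_inv (act (fst x)))"

definition pstep :: "'l \<times> bool \<Rightarrow> 'a \<Rightarrow> 'a" where
  "pstep x = (if snd x then perm (fst x) else inv_into A (perm (fst x)))"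

primrec run :: "'l word \<Rightarrow> 'a \<rightharpoonup> 'a" where
  "run [] = Some"
| "run (x # w) = run w \<circ>\<^sub>m step x"

primrec prun :: "'l word \<Rightarrow> 'a \<Rightarrow> 'a" where
  "prun [] = id"
| "prun (x # w) = prun w \<circ> pstep x"

text \<open>Level 0 is the permutation group generated by the \<open>perm l\<close>; each further
  level adds the edge parities of the one below. Higher levels are finer.\<close>

primrec eqv :: "nat \<Rightarrow> 'l word \<Rightarrow> 'l word \<Rightarrow> bool" where
  "eqv 0 = (\<lambda>u v. \<forall>a \<in> A. prun u a = prun v a)"
| "eqv (Suc k) = refine (eqv k)"

lemma act_inj: "inj_on (act l) (dom (act l))"
proof (rule inj_onI)
  fix a b assume ab: "a \<in> dom (act l)" "b \<in> dom (act l)" "act l a = act l b"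
  then obtain c where c: "act l a = Some c" "act l b = Some c" by auto
  then have "perm l a = perm l b" "a \<in> A" "b \<in> A" using act_perm act_dom by auto
  then show "a = b" using perm_bij[of l] by (auto simp: bij_betw_def inj_on_def)
qed

lemma step_False_iff: "map_inv (act l) b = Some a \<longleftrightarrow> act l a = Some b"
proof
  assume "map_inv (act l) b = Some a"
  moreover from this obtain a' where "act l a' = Some b"
    by (auto simp: map_inv_def ran_def split: if_splits)
  moreover from this have "map_inv (act l) b = Some a'" by (rule map_inv_eq_Some[OF act_inj])
  ultimately show "act l a = Some b" by simp
qed (rule map_inv_eq_Some[OF act_inj])

lemma step_flip: "step (flip x) b = Some a \<longleftrightarrow> step x a = Some b"
  by (auto simp: step_def flip_def step_False_iff)

lemma pstep_in: "a \<in> A \<Longrightarrow> pstep x a \<in> A"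
  using perm_bij[of "fst x"]
  by (auto simp: pstep_def bij_betw_def inv_into_into)

lemma pstep_flip: "a \<in> A \<Longrightarrow> pstep (flip x) (pstep x a) = a"
  using perm_bij[of "fst x"]
  by (auto simp: pstep_def flip_def bij_betw_inv_into_left bij_betw_inv_into_right)

lemma step_pstep: "step x a = Some b \<Longrightarrow> a \<in> A \<and> b \<in> A \<and> pstep x a = b"
proof -
  have act: "a \<in> A \<and> b \<in> A \<and> perm l a = b" if "act l a = Some b" for l a b
    using act_dom[OF that] act_perm[OF that] perm_bij[of l] by (auto simp: bij_betw_def)
  assume "step x a = Some b"
  then show ?thesis
    using act[of "fst x" a b] act[of "fst x" b a] perm_bij[of "fst x"]
    by (auto simp: step_def pstep_def step_False_iff bij_betw_inv_into_left split: if_splits)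
qed

lemma run_append: "run (u @ w) a = Some c \<longleftrightarrow> (\<exists>b. run u a = Some b \<and> run w b = Some c)"
  by (induction u arbitrary: a) (auto simp: map_comp_Some_iff)

lemma prun_append: "prun (u @ w) a = prun w (prun u a)"
  by (induction u arbitrary: a) auto

lemma run_winv: "run w a = Some b \<Longrightarrow> run (winv w) b = Some a"
  by (induction w arbitrary: a)
    (auto simp: winv_simps run_append map_comp_Some_iff step_flip)

lemma prun_in: "a \<in> A \<Longrightarrow> prun u a \<in> A"
  by (induction u arbitrary: a) (auto simp: pstep_in)

lemma run_prun: "run u a = Some b \<Longrightarrow> a \<in> A \<Longrightarrow> b \<in> A \<and> prun u a = b"
  by (induction u arbitrary: a) (auto simp: map_comp_Some_iff dest: step_pstep)

lemma word_cong_eqv: "word_cong (eqv k)"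
proof (induction k)
  case 0
  show ?case
    unfolding word_cong_def
  proof (intro conjI allI impI)
    show "equivp (eqv 0)" by (intro equivpI reflpI sympI transpI) auto
  qed (auto simp: prun_append prun_in pstep_flip)
next
  case (Suc k)
  then show ?case using word_cong_refine by simp
qed

lemmas eqv_refl = word_cong_refl[OF word_cong_eqv]
  and eqv_sym = word_cong_sym[OF word_cong_eqv]
  and eqv_trans = word_cong_trans[OF word_cong_eqv]
  and eqv_left = word_cong_left[OF word_cong_eqv]
  and eqv_right = word_cong_right[OF word_cong_eqv]
  and eqv_flip = word_cong_flip[OF word_cong_eqv]
  and eqv_cancel = word_cong_cancel[OF word_cong_eqv]

lemma eqv_Suc: "eqv (Suc k) u v \<Longrightarrow> eqv k u v"
  by (simp add: refine_def)

lemma eqv_0: "eqv k u v \<Longrightarrow> eqv 0 u v"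
  by (induction k) (use eqv_Suc in blast)+

lemma finite_eqv:
  assumes "finite L"
  shows "finite (eqv k ` lists (L \<times> UNIV))"
proof (induction k)
  case 0
  let ?g = "\<lambda>w. {(a, prun w a) | a. a \<in> A}"
  have "?g ` lists (L \<times> UNIV) \<subseteq> Pow (A \<times> A)" using prun_in by auto
  then have "finite (?g ` lists (L \<times> UNIV))" by (rule finite_subset) (use finite_A in simp)
  then show ?case
  proof (rule finite_image_factor)
    fix w w' assume "?g w = ?g w'"
    then have "eqv 0 w w'" by (fastforce simp: set_eq_iff)
    then show "eqv 0 w = eqv 0 w'" by (rule word_cong_eq[OF word_cong_eqv])
  qed
next
  case (Suc k)
  then show ?case using finite_refine[OF word_cong_eqv assms] by simp
qed

text \<open>A pair \<open>s = (a, w)\<close> represents the copy of \<open>a\<close> in the chart of \<open>w\<close>. At level \<open>k\<close> this point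
  lies in the chart of \<open>v\<close> as the copy of \<open>b\<close>.\<close>

definition lies :: "nat \<Rightarrow> 'a \<times> 'l word \<Rightarrow> 'l word \<Rightarrow> 'a \<Rightarrow> bool" where
  "lies k s v b \<longleftrightarrow> fst s \<in> A \<and> (\<exists>u. run u (fst s) = Some b \<and> eqv k (snd s @ u) v)"

definition inside :: "nat \<Rightarrow> 'a \<times> 'l word \<Rightarrow> 'l word \<Rightarrow> bool" where
  "inside k s v \<longleftrightarrow> (\<exists>b. lies k s v b)"

lemma lies_refl: "a \<in> A \<Longrightarrow> lies k (a, w) w a"
  by (auto simp: lies_def eqv_refl intro!: exI[of _ "[]"])

lemma lies_in: "lies k s v b \<Longrightarrow> b \<in> A"
  by (auto simp: lies_def dest: run_prun)

lemma lies_Suc: "lies (Suc k) s v b \<Longrightarrow> lies k s v b"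
  using eqv_Suc unfolding lies_def by blast

lemma lies_mono: "j \<le> k \<Longrightarrow> lies k s v b \<Longrightarrow> lies j s v b"
  by (induction rule: dec_induct) (auto dest: lies_Suc)

lemma inside_Suc: "inside (Suc k) s v \<Longrightarrow> inside k s v"
  using lies_Suc unfolding inside_def by blast

lemma lies_cong: "lies k s v b \<Longrightarrow> eqv k v v' \<Longrightarrow> lies k s v' b"
  using eqv_trans unfolding lies_def by blast

lemma inside_cong: "eqv k v v' \<Longrightarrow> inside k s v = inside k s v'"
  using lies_cong eqv_sym unfolding inside_def by blast

text \<open>This is the purpose of level 0: two runs that lead into the same chart are words equal
  at level 0, so their permutations agree at \<open>fst s\<close>, and runs agree with permutations
  wherever they are defined.\<close>

lemma lies_unique:
  assumes "lies k s v b" "lies k s v b'"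
  shows "b = b'"
proof -
  obtain u u' where u: "run u (fst s) = Some b" "eqv k (snd s @ u) v" "fst s \<in> A"
    "run u' (fst s) = Some b'" "eqv k (snd s @ u') v"
    using assms by (auto simp: lies_def)
  have "eqv k (snd s @ u) (snd s @ u')" by (rule eqv_trans[OF u(2) eqv_sym[OF u(5)]])
  then have "eqv 0 u u'" by (simp add: eqv_cancel eqv_0 del: eqv.simps)
  then show ?thesis using run_prun u by fastforce
qed

lemma lies_run:
  assumes "lies k s v b" "run u b = Some c"
  shows "lies k s (v @ u) c"
proof -
  obtain w where w: "run w (fst s) = Some b" "eqv k (snd s @ w) v" "fst s \<in> A"
    using assms by (auto simp: lies_def)
  have "eqv k (snd s @ (w @ u)) (v @ u)" using eqv_right[OF w(2), of u] by simp
  then show ?thesis using w assms(2) unfolding lies_def by (metis run_append)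
qed

text \<open>Back along the first run to the representative of \<open>s\<close>, then forth along the
  second.\<close>

lemma lies_path:
  assumes "lies k s v b" "lies k s v' b'"
  obtains u where "run u b = Some b'" "eqv k (v @ u) v'"
proof -
  obtain w w' where w: "run w (fst s) = Some b" "eqv k (snd s @ w) v" "fst s \<in> A"
    "run w' (fst s) = Some b'" "eqv k (snd s @ w') v'"
    using assms by (auto simp: lies_def)
  have "run (winv w @ w') b = Some b'" using run_winv[OF w(1)] w(4) by (auto simp: run_append)
  moreover have "eqv k (v @ winv w @ w') v'"
  proof -
    have "eqv k ((snd s @ w) @ winv w @ w') (v @ winv w @ w')" using w(2) by (rule eqv_right)
    moreover have "eqv k (snd s @ (w @ winv w) @ w') (snd s @ [] @ w')"
      by (intro eqv_left eqv_right word_cong_winv[OF word_cong_eqv])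
    ultimately have "eqv k (v @ winv w @ w') (snd s @ w')"
      using eqv_sym eqv_trans by (metis append.assoc append_Nil)
    then show ?thesis using w(5) by (rule eqv_trans)
  qed
  ultimately show ?thesis by (rule that)
qed

text \<open>The recorded vertex is the one from which \<open>act l\<close> leads on: the start for a
  letter \<open>(l, True)\<close>, the far end for \<open>(l, False)\<close>. As a consequence, a
  point carried along a path belongs to the charts at both ends of every edge passed.\<close>

lemma edge_on_path:
  assumes "lies k s v b" "run u b = Some c" "(y, l) \<in> set (edges v u)"
  shows "\<exists>a a'. lies k s y a \<and> act l a = Some a'"
  using assms
proof (induction u arbitrary: v b)
  case (Cons x u)
  obtain d where d: "step x b = Some d" "run u d = Some c"
    using Cons.prems(2) by (auto simp: map_comp_Some_iff)
  have v': "lies k s (v @ [x]) d" using lies_run[OF Cons.prems(1), of "[x]" d] d by simp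
  show ?case
  proof (cases "(y, l) \<in> set (edges (v @ [x]) u)")
    case True
    then show ?thesis using Cons.IH[OF v' d(2)] by blast
  next
    case False
    then have y: "y = (if snd x then v else v @ [x])" "l = fst x" using Cons.prems(3) by auto
    show ?thesis
      using Cons.prems(1) v' d(1) y by (cases "snd x") (auto simp: step_def step_False_iff)
  qed
qed simp

lemma edge_inside:
  assumes "lies k s v b" "run u b = Some c" "(y, l) \<in> set (edges v u)"
  shows "inside k s y" "inside k s (y @ [(l, True)])"
proof -
  obtain a a' where a: "lies k s y a" "act l a = Some a'" using edge_on_path[OF assms] by blast
  then show "inside k s y" by (auto simp: inside_def)
  have "run [(l, True)] a = Some a'" using a(2) by (simp add: step_def)
  from lies_run[OF a(1) this] show "inside k s (y @ [(l, True)])" by (auto simp: inside_def)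
qed

text \<open>One word moves all common points of two charts simultaneously, at the price of one
  level. Each common point has its own path from \<open>v\<close> to \<open>v'\<close>, and these
  paths are all equal at level \<open>Suc k\<close>. Let \<open>Q\<close> be the set of charts
  reached from \<open>v\<close> by words defined on every common point. If \<open>v'\<close> were
  outside \<open>Q\<close>, some boundary edge of \<open>Q\<close> would lie on all these paths; its
  letter would then act on every common point, and \<open>Q\<close> would extend across the
  edge.\<close>

lemma transition:
  assumes t: "inside (Suc k) t v" "inside (Suc k) t v'"
  shows "\<exists>u. eqv k (v @ u) v' \<and>
    (\<forall>s b b'. lies (Suc k) s v b \<longrightarrow> lies (Suc k) s v' b' \<longrightarrow> run u b = Some b')"
proof -
  define common where "common s b b' \<longleftrightarrow> lies (Suc k) s v b \<and> lies (Suc k) s v' b'" for s b b'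
  define Q where "Q x \<longleftrightarrow> (\<exists>u. eqv k (v @ u) x \<and> (\<forall>s b b'. common s b b' \<longrightarrow> run u b \<noteq> None))" for x
  have Q_cong: "Q x = Q y" if "eqv k x y" for x y
    using eqv_trans eqv_sym that unfolding Q_def by blast
  have lies_v: "lies k s (v @ u) c" if "common s b b'" "run u b = Some c" for s b b' u c
    using that lies_run lies_Suc unfolding common_def by blast
  have "Q v'"
  proof (rule ccontr)
    assume "\<not> Q v'"
    obtain b0 b0' where "common t b0 b0'" using t by (auto simp: common_def inside_def)
    then obtain u0 where u0: "eqv (Suc k) (v @ u0) v'"
      using lies_path[of "Suc k" t v b0 v' b0'] unfolding common_def by blast
    have "Q v" unfolding Q_def by (intro exI[of _ "[]"]) (simp add: eqv_refl)
    moreover have "\<not> Q (v @ u0)" using Q_cong[OF eqv_Suc[OF u0]] \<open>\<not> Q v'\<close> by simp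
    ultimately obtain x l where cross: "Q x \<noteq> Q (x @ [(l, True)])"
      and edge: "\<And>u'. refine (eqv k) u0 u' \<Longrightarrow> \<exists>y. (y, l) \<in> set (edges v u') \<and> eqv k x y"
      using cut_edge[of "eqv k" Q v u0, OF word_cong_eqv Q_cong] by blast
    \<comment> \<open>Whichever common point \<open>s\<close> is taken, its own path runs through
      the boundary edge chosen for \<open>u0\<close>.\<close>
    have act: "\<exists>a a'. lies k s x a \<and> act l a = Some a'" if s: "common s b b'" for s b b'
    proof -
      obtain u where u: "run u b = Some b'" "eqv (Suc k) (v @ u) v'"
        using lies_path[of "Suc k" s v b v' b'] s unfolding common_def by blast
      have "eqv (Suc k) (v @ u0) (v @ u)" by (rule eqv_trans[OF u0 eqv_sym[OF u(2)]])
      then have "refine (eqv k) u0 u" by (simp only: eqv_cancel flip: eqv.simps(2))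
      then obtain y where y: "(y, l) \<in> set (edges v u)" "eqv k x y" using edge by blast
      have "lies k s v b" using s lies_Suc unfolding common_def by blast
      then obtain a a' where "lies k s y a" "act l a = Some a'"
        using edge_on_path[OF _ u(1) y(1)] by blast
      then show ?thesis using lies_cong eqv_sym[OF y(2)] by blast
    qed
    show False
    proof (cases "Q x")
      case True
      then obtain u where u: "eqv k (v @ u) x" "\<forall>s b b'. common s b b' \<longrightarrow> run u b \<noteq> None"
        by (auto simp: Q_def)
      have "run (u @ [(l, True)]) b \<noteq> None" if s: "common s b b'" for s b b'
      proof -
        obtain c where c: "run u b = Some c" using u(2) s by blast
        obtain a a' where a: "lies k s x a" "act l a = Some a'" using act[OF s] by blast
        have "c = a" using lies_unique[OF lies_cong[OF lies_v[OF s c] u(1)] a(1)] .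
        then have "run (u @ [(l, True)]) b = Some a'" using a(2) c by (simp add: run_append step_def)
        then show ?thesis by simp
      qed
      moreover have "eqv k (v @ u @ [(l, True)]) (x @ [(l, True)])"
        using eqv_right[OF u(1)] by simp
      ultimately have "Q (x @ [(l, True)])" unfolding Q_def by blast
      then show False using True cross by simp
    next
      case False
      then have "Q (x @ [(l, True)])" using cross by simp
      then obtain u where u: "eqv k (v @ u) (x @ [(l, True)])"
        "\<forall>s b b'. common s b b' \<longrightarrow> run u b \<noteq> None"
        by (auto simp: Q_def)
      have "run (u @ [(l, False)]) b \<noteq> None" if s: "common s b b'" for s b b'
      proof -
        obtain c where c: "run u b = Some c" using u(2) s by blast
        obtain a a' where a: "lies k s x a" "act l a = Some a'" using act[OF s] by blast
        have "lies k s (x @ [(l, True)]) a'"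
          using lies_run[OF a(1), of "[(l, True)]" a'] a(2) by (simp add: step_def)
        then have "c = a'" using lies_unique[OF lies_cong[OF lies_v[OF s c] u(1)]] by blast
        then have "run (u @ [(l, False)]) b = Some a"
          using a(2) c by (simp add: run_append step_def step_False_iff)
        then show ?thesis by simp
      qed
      moreover have "eqv k (v @ u @ [(l, False)]) x"
      proof -
        have "eqv k (v @ u @ [(l, False)]) (x @ [(l, True), (l, False)])"
          using eqv_right[OF u(1), of "[(l, False)]"] by simp
        moreover have "eqv k (x @ [(l, True), (l, False)]) (x @ [])"
          using eqv_left[OF eqv_flip[of k "(l, True)"]] by (simp add: flip_def)
        ultimately show ?thesis by (auto intro: eqv_trans)
      qed
      ultimately have "Q x" unfolding Q_def by blast
      then show False using False by simp
    qed
  qed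
  then obtain u where u: "eqv k (v @ u) v'" "\<forall>s b b'. common s b b' \<longrightarrow> run u b \<noteq> None"
    by (auto simp: Q_def)
  have "run u b = Some b'" if s: "lies (Suc k) s v b" "lies (Suc k) s v' b'" for s b b'
  proof -
    have s': "common s b b'" using s by (simp add: common_def)
    then obtain c where c: "run u b = Some c" using u(2) by blast
    have "c = b'" using lies_unique[OF lies_cong[OF lies_v[OF s' c] u(1)] lies_Suc[OF s(2)]] .
    then show ?thesis using c by simp
  qed
  then show ?thesis using u(1) by blast
qed

end

section \<open>Acyclicity of the quotients\<close>

context partial_perms
begin

text \<open>There are two routes from \<open>v 0\<close> to \<open>v (n - 1)\<close>: the word
  \<open>u\<close> stays in charts of \<open>s 0\<close>, and \<open>r\<close> goes the long way
  round through charts of the other points. The set \<open>Q\<close> of charts that contain both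
  \<open>s 0\<close> and \<open>s 1\<close> separates the ends, so both routes use a common boundary
  edge of \<open>Q\<close>. Both ends of that edge contain \<open>s 0\<close> and some other
  \<open>s j\<close>, and chordlessness leaves no possible \<open>j\<close>.\<close>

lemma no_chordless_cycle:
  fixes s :: "nat \<Rightarrow> 'a \<times> 'l word"
  assumes n: "n > 3"
    and v: "\<And>i. i < n \<Longrightarrow> inside (Suc k) (s i) (v i) \<and> inside (Suc k) (s (Suc i mod n)) (v i)"
    and chordless: "\<And>i j x. i < n \<Longrightarrow> j < n \<Longrightarrow> inside k (s i) x \<Longrightarrow> inside k (s j) x \<Longrightarrow>
      i = j \<or> j = Suc i mod n \<or> i = Suc j mod n"
  shows False
proof -
  \<comment> \<open>The long way round; the index \<open>j\<close> starts at 1, so each edge of it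
    is attributed to a point other than \<open>s 0\<close>.\<close>
  have walk: "\<exists>r. eqv (Suc k) (v 0 @ r) (v m) \<and> (\<forall>(y, l) \<in> set (edges (v 0) r).
      \<exists>j \<in> {1..m}. inside k (s j) y \<and> inside k (s j) (y @ [(l, True)]))" if "m < n" for m
    using that
  proof (induction m)
    case 0
    show ?case by (intro exI[of _ "[]"]) (simp add: eqv_refl del: eqv.simps)
  next
    case (Suc m)
    then obtain r where r: "eqv (Suc k) (v 0 @ r) (v m)" "\<forall>(y, l) \<in> set (edges (v 0) r).
      \<exists>j \<in> {1..m}. inside k (s j) y \<and> inside k (s j) (y @ [(l, True)])" by auto
    obtain b b' where b: "lies (Suc k) (s (Suc m)) (v m) b" "lies (Suc k) (s (Suc m)) (v (Suc m)) b'"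
      using v[of m] v[of "Suc m"] Suc.prems by (auto simp: inside_def)
    have b0: "lies (Suc k) (s (Suc m)) (v 0 @ r) b" using lies_cong[OF b(1) eqv_sym[OF r(1)]] .
    obtain u where u: "run u b = Some b'" "eqv (Suc k) ((v 0 @ r) @ u) (v (Suc m))"
      using lies_path[OF b0 b(2)] by blast
    have "\<exists>j \<in> {1..Suc m}. inside k (s j) y \<and> inside k (s j) (y @ [(l, True)])"
      if "(y, l) \<in> set (edges (v 0) (r @ u))" for y l
    proof (cases "(y, l) \<in> set (edges (v 0) r)")
      case True
      then show ?thesis using r(2) by fastforce
    next
      case False
      then have "(y, l) \<in> set (edges (v 0 @ r) u)" using that by (auto simp: edges_append)
      from edge_inside[OF lies_Suc[OF b0] u(1) this] show ?thesis by force
    qed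
    then show ?case using u(2) by (intro exI[of _ "r @ u"]) auto
  qed
  have "n - 1 < n" using n by simp
  then obtain r where r: "eqv (Suc k) (v 0 @ r) (v (n - 1))"
    "\<forall>(y, l) \<in> set (edges (v 0) r).
      \<exists>j \<in> {1..n - 1}. inside k (s j) y \<and> inside k (s j) (y @ [(l, True)])"
    using walk by blast
  have "Suc (n - 1) mod n = 0" using n by simp
  then obtain b b' where b: "lies (Suc k) (s 0) (v 0) b" "lies (Suc k) (s 0) (v (n - 1)) b'"
    using v[of 0] v[of "n - 1"] n by (auto simp: inside_def)
  obtain u where u: "run u b = Some b'" "eqv (Suc k) (v 0 @ u) (v (n - 1))"
    using lies_path[OF b] by blast
  have "eqv (Suc k) (v 0 @ u) (v 0 @ r)" by (rule eqv_trans[OF u(2) eqv_sym[OF r(1)]])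
  then have ur: "refine (eqv k) u r" by (simp only: eqv_cancel flip: eqv.simps(2))
  have uu: "refine (eqv k) u u" using eqv_refl[of "Suc k"] by simp
  define Q where "Q x \<longleftrightarrow> inside k (s 0) x \<and> inside k (s 1) x" for x
  have Q_cong: "Q x = Q y" if "eqv k x y" for x y
    using inside_cong[OF that] by (simp add: Q_def)
  \<comment> \<open>The length matters here: in a triangle the points 1 and \<open>n - 1\<close> are
    consecutive.\<close>
  have far: "\<not> (inside k (s 1) x \<and> inside k (s (n - 1)) x)" for x
    using chordless[of 1 "n - 1" x] n by (auto simp: mod_Suc)
  have "Q (v 0)" using v[of 0] n inside_Suc by (auto simp: Q_def)
  moreover have "\<not> Q (v 0 @ u)"
  proof -
    have "inside k (s (n - 1)) (v (n - 1))" using v[of "n - 1"] n inside_Suc by simp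
    then show ?thesis using Q_cong[OF eqv_Suc[OF u(2)]] far by (auto simp: Q_def)
  qed
  ultimately obtain x l where cross: "Q x \<noteq> Q (x @ [(l, True)])"
    and edge: "\<And>u'. refine (eqv k) u u' \<Longrightarrow> \<exists>y. (y, l) \<in> set (edges (v 0) u') \<and> eqv k x y"
    using cut_edge[of "eqv k" Q "v 0" u, OF word_cong_eqv Q_cong] by blast
  have shift: "inside k t x \<and> inside k t (x @ [(l, True)])"
    if "inside k t y" "inside k t (y @ [(l, True)])" "eqv k x y" for t y
    using that inside_cong[OF that(3)] inside_cong[OF eqv_right[OF that(3)]] by simp
  obtain y where y: "(y, l) \<in> set (edges (v 0) u)" "eqv k x y" using edge[OF uu] by blast
  have s0: "inside k (s 0) x" "inside k (s 0) (x @ [(l, True)])"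
    using shift[OF edge_inside[OF lies_Suc[OF b(1)] u(1) y(1)] y(2)] by simp_all
  obtain z where z: "(z, l) \<in> set (edges (v 0) r)" "eqv k x z" using edge[OF ur] by blast
  then obtain j where j: "j \<in> {1..n - 1}" "inside k (s j) z" "inside k (s j) (z @ [(l, True)])"
    using r(2) by fastforce
  then have sj: "inside k (s j) x" "inside k (s j) (x @ [(l, True)])" using shift z(2) by blast+
  have "0 = j \<or> j = Suc 0 mod n \<or> 0 = Suc j mod n"
    using chordless[OF _ _ s0(1) sj(1)] j(1) n by auto
  \<comment> \<open>For \<open>j = 1\<close> both ends of the edge would lie in \<open>Q\<close>,
    for \<open>j = n - 1\<close> neither would, so it could not be a boundary edge.\<close>
  then have "j = 1 \<or> j = n - 1" using j(1) n by (auto simp: mod_Suc split: if_splits)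
  then show False using cross s0 sj far by (auto simp: Q_def)
qed

text \<open>A Helly property that costs two levels, one for \<open>transition\<close> and one for
  the cut. The direct route \<open>u\<close> from \<open>x\<^sub>1\<close> to
  \<open>x\<^sub>2\<close> is compared with the detour \<open>r\<close>, \<open>r'\<close> over
  \<open>x\<^sub>3\<close>; the cut \<open>Q\<close> consists of the charts that contain
  \<open>D - {s\<^sub>1}\<close>. A shared boundary edge on \<open>r\<close> would have both ends in
  \<open>Q\<close>, because the points carried by \<open>u\<close> and by \<open>r\<close> together
  exhaust \<open>D - {s\<^sub>1}\<close>. On \<open>r'\<close> it gives a chart that contains all of
  \<open>D\<close>.\<close>

lemma helly:
  assumes D: "s\<^sub>1 \<in> D" "s\<^sub>2 \<in> D" "s\<^sub>3 \<in> D" "s\<^sub>1 \<noteq> s\<^sub>2" "s\<^sub>1 \<noteq> s\<^sub>3" "s\<^sub>2 \<noteq> s\<^sub>3"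
    and x: "\<forall>s \<in> D - {s\<^sub>1}. inside (Suc (Suc k)) s x\<^sub>1" "\<forall>s \<in> D - {s\<^sub>2}. inside (Suc (Suc k)) s x\<^sub>2"
      "\<forall>s \<in> D - {s\<^sub>3}. inside (Suc (Suc k)) s x\<^sub>3"
  shows "\<exists>x. \<forall>s \<in> D. inside k s x"
proof (rule ccontr)
  assume none: "\<not> ?thesis"
  \<comment> \<open>All points of \<open>D - {a, b}\<close> travel along one word. The point
    \<open>c\<close> provides the common point that \<open>transition\<close> starts from; having
    three distinct points in \<open>D\<close> ensures that there is one.\<close>
  have path: "\<exists>u. eqv (Suc k) (z @ u) z' \<and> (\<forall>(y, l) \<in> set (edges z u). \<forall>s \<in> D - {a, b}.
      inside k s y \<and> inside k s (y @ [(l, True)]))"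
    if "c \<in> D - {a, b}" "\<forall>s \<in> D - {a}. inside (Suc (Suc k)) s z"
      "\<forall>s \<in> D - {b}. inside (Suc (Suc k)) s z'" for a b c z z'
  proof -
    have c: "inside (Suc (Suc k)) c z" "inside (Suc (Suc k)) c z'" using that by auto
    obtain u where u: "eqv (Suc k) (z @ u) z'"
      "\<forall>s b b'. lies (Suc (Suc k)) s z b \<longrightarrow> lies (Suc (Suc k)) s z' b' \<longrightarrow> run u b = Some b'"
      using transition[OF c] by blast
    have "inside k s y \<and> inside k s (y @ [(l, True)])"
      if yl: "(y, l) \<in> set (edges z u)" and s: "s \<in> D - {a, b}" for y l s
    proof -
      obtain d d' where d: "lies (Suc (Suc k)) s z d" "lies (Suc (Suc k)) s z' d'"
        using s \<open>\<forall>s \<in> D - {a}. inside (Suc (Suc k)) s z\<close>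
          \<open>\<forall>s \<in> D - {b}. inside (Suc (Suc k)) s z'\<close> by (fastforce simp: inside_def)
      show ?thesis
        using edge_inside[OF lies_Suc[OF lies_Suc[OF d(1)]] u(2)[rule_format, OF d] yl] by blast
    qed
    then show ?thesis using u(1) by blast
  qed
  obtain u where u: "eqv (Suc k) (x\<^sub>1 @ u) x\<^sub>2" "\<forall>(y, l) \<in> set (edges x\<^sub>1 u). \<forall>s \<in> D - {s\<^sub>1, s\<^sub>2}.
      inside k s y \<and> inside k s (y @ [(l, True)])"
    using path[of s\<^sub>3 s\<^sub>1 s\<^sub>2 x\<^sub>1 x\<^sub>2] D x by blast
  obtain r where r: "eqv (Suc k) (x\<^sub>1 @ r) x\<^sub>3" "\<forall>(y, l) \<in> set (edges x\<^sub>1 r). \<forall>s \<in> D - {s\<^sub>1, s\<^sub>3}.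
      inside k s y \<and> inside k s (y @ [(l, True)])"
    using path[of s\<^sub>2 s\<^sub>1 s\<^sub>3 x\<^sub>1 x\<^sub>3] D x by blast
  obtain r' where r': "eqv (Suc k) (x\<^sub>3 @ r') x\<^sub>2" "\<forall>(y, l) \<in> set (edges x\<^sub>3 r'). \<forall>s \<in> D - {s\<^sub>3, s\<^sub>2}.
      inside k s y \<and> inside k s (y @ [(l, True)])"
    using path[of s\<^sub>1 s\<^sub>3 s\<^sub>2 x\<^sub>3 x\<^sub>2] D x by blast
  define Q where "Q x \<longleftrightarrow> (\<forall>s \<in> D - {s\<^sub>1}. inside k s x)" for x
  have Q_cong: "Q x = Q y" if "eqv k x y" for x y
    using inside_cong[OF that] by (simp add: Q_def)
  have "eqv (Suc k) (x\<^sub>1 @ r @ r') x\<^sub>2"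
    using eqv_trans[OF eqv_right[OF r(1), of r'] r'(1)] by simp
  then have "eqv (Suc k) (x\<^sub>1 @ u) (x\<^sub>1 @ r @ r')" using u(1) eqv_sym eqv_trans by blast
  then have urr: "refine (eqv k) u (r @ r')" by (simp only: eqv_cancel flip: eqv.simps(2))
  have uu: "refine (eqv k) u u" using eqv_refl[of "Suc k"] by simp
  have "Q x\<^sub>1" using x(1) inside_Suc by (auto simp: Q_def)
  moreover have "\<not> Q (x\<^sub>1 @ u)"
  proof
    assume "Q (x\<^sub>1 @ u)"
    then have "Q x\<^sub>2" using Q_cong[OF eqv_Suc[OF u(1)]] by simp
    moreover have "inside k s\<^sub>1 x\<^sub>2" using x(2) D inside_Suc by blast
    ultimately have "\<forall>s \<in> D. inside k s x\<^sub>2" by (auto simp: Q_def)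
    then show False using none by blast
  qed
  ultimately obtain x l where cross: "Q x \<noteq> Q (x @ [(l, True)])"
    and edge: "\<And>u'. refine (eqv k) u u' \<Longrightarrow> \<exists>y. (y, l) \<in> set (edges x\<^sub>1 u') \<and> eqv k x y"
    using cut_edge[of "eqv k" Q x\<^sub>1 u, OF word_cong_eqv Q_cong] by blast
  have shift: "inside k t x \<and> inside k t (x @ [(l, True)])"
    if "inside k t y" "inside k t (y @ [(l, True)])" "eqv k x y" for t y
    using that inside_cong[OF that(3)] inside_cong[OF eqv_right[OF that(3)]] by simp
  obtain y where "(y, l) \<in> set (edges x\<^sub>1 u)" "eqv k x y" using edge[OF uu] by blast
  then have 12: "inside k s x \<and> inside k s (x @ [(l, True)])" if "s \<in> D - {s\<^sub>1, s\<^sub>2}" for s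
    using u(2) that shift by blast
  obtain z where z: "(z, l) \<in> set (edges x\<^sub>1 (r @ r'))" "eqv k x z" using edge[OF urr] by blast
  show False
  proof (cases "(z, l) \<in> set (edges x\<^sub>1 r)")
    case True
    then have 13: "inside k s x \<and> inside k s (x @ [(l, True)])" if "s \<in> D - {s\<^sub>1, s\<^sub>3}" for s
      using r(2) that shift z(2) by blast
    have "inside k s x \<and> inside k s (x @ [(l, True)])" if "s \<in> D - {s\<^sub>1}" for s
      using 12[of s] 13[of s] that D by blast
    then show False using cross by (auto simp: Q_def)
  next
    case False
    then have z': "(z, l) \<in> set (edges (x\<^sub>1 @ r) r')" using z(1) by (simp add: edges_append)
    obtain w where "(w, l) \<in> set (edges x\<^sub>3 r')" "eqv k z w"
      using edges_base_cong[OF word_cong_eqv eqv_Suc[OF r(1)] z'] by blast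
    then have 23: "inside k s x \<and> inside k s (x @ [(l, True)])" if "s \<in> D - {s\<^sub>3, s\<^sub>2}" for s
      using r'(2) that shift eqv_trans[OF z(2)] by blast
    \<comment> \<open>One end of the edge is in \<open>Q\<close> and so contains every point of
      \<open>D\<close> except possibly \<open>s\<^sub>1\<close>, which is carried along
      \<open>r'\<close>.\<close>
    have "\<exists>x'. Q x' \<and> inside k s\<^sub>1 x'"
      using cross 23[of s\<^sub>1] D by (cases "Q x") auto
    then obtain x' where "Q x'" "inside k s\<^sub>1 x'" by blast
    then have "\<forall>s \<in> D. inside k s x'" by (auto simp: Q_def)
    then show False using none by blast
  qed
qed

definition common :: "nat \<Rightarrow> ('a \<times> 'l word) set \<Rightarrow> bool" where
  "common k D \<longleftrightarrow> (\<exists>v. \<forall>s \<in> D. inside k s v)"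

lemma common_Suc: "common (Suc k) D \<Longrightarrow> common k D"
  using inside_Suc unfolding common_def by blast

text \<open>Stability makes sharing a chart mean the same at levels \<open>k\<close>,
  \<open>k + 1\<close> and \<open>k + 2\<close> for subsets of \<open>T\<close>. A chordless cycle
  at level \<open>k + 1\<close> is then still chordless at level \<open>k\<close>, where the cycle
  lemma excludes it. Cliques drop to level \<open>k\<close> by \<open>helly\<close> and are lifted
  back by stability.\<close>

lemma acyclic_of_stable:
  assumes "finite T" and T: "\<And>s. s \<in> T \<Longrightarrow> fst s \<in> A"
    and stable: "\<And>D. D \<subseteq> T \<Longrightarrow> common k D \<Longrightarrow> common (Suc (Suc k)) D"
  shows "hg_acyclic T (induced_hyperedges (range (\<lambda>v. {s. inside (Suc k) s v})) T)"
    (is "hg_acyclic T ?U")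
proof -
  have gaifman_iff: "gaifman ?U a b \<longleftrightarrow> a \<noteq> b \<and> common (Suc k) {a, b}" if "a \<in> T" "b \<in> T" for a b
    using that by (auto simp: gaifman_def induced_hyperedges_def common_def)
  have gaifman_in: "a \<in> T \<and> b \<in> T" if "gaifman ?U a b" for a b
    using that by (auto simp: gaifman_def induced_hyperedges_def)
  have no_cycle: False if xs: "set xs \<subseteq> T" "length xs > 3" "cycle (gaifman ?U) xs"
      "chordless (gaifman ?U) xs" for xs
  proof -
    let ?n = "length xs"
    have "\<exists>v. inside (Suc k) (xs ! i) v \<and> inside (Suc k) (xs ! (Suc i mod ?n)) v" if i: "i < ?n" for i
    proof -
      have g: "gaifman ?U (xs ! i) (xs ! (Suc i mod ?n))" using xs(3) i by (simp add: cycle_def)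
      then have "common (Suc k) {xs ! i, xs ! (Suc i mod ?n)}"
        using gaifman_iff gaifman_in by blast
      then show ?thesis by (auto simp: common_def)
    qed
    then obtain v where v: "\<And>i. i < ?n \<Longrightarrow>
        inside (Suc k) (xs ! i) (v i) \<and> inside (Suc k) (xs ! (Suc i mod ?n)) (v i)" by metis
    show False
    proof (rule no_chordless_cycle[where s = "(!) xs" and v = v, OF xs(2)])
      show "inside (Suc k) (xs ! i) (v i) \<and> inside (Suc k) (xs ! (Suc i mod ?n)) (v i)"
        if "i < ?n" for i using v[OF that] .
    next
      fix i j x assume ij: "i < ?n" "j < ?n" and x: "inside k (xs ! i) x" "inside k (xs ! j) x"
      have in_T: "xs ! i \<in> T" "xs ! j \<in> T" using ij xs(1) nth_mem by blast+
      have "common k {xs ! i, xs ! j}" using x by (auto simp: common_def)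
      then have "common (Suc k) {xs ! i, xs ! j}" using in_T by (intro common_Suc[OF stable]) simp_all
      then have "xs ! i = xs ! j \<or> gaifman ?U (xs ! i) (xs ! j)" using gaifman_iff[OF in_T] by blast
      then show "i = j \<or> j = Suc i mod ?n \<or> i = Suc j mod ?n"
        using xs(3,4) ij by (auto simp: cycle_def chordless_def nth_eq_iff_index_eq)
    qed
  qed
  \<comment> \<open>Proved at level \<open>k + 2\<close> although only \<open>k + 1\<close> is asked
    for, so that the induction hypothesis can feed \<open>helly\<close>. Cliques with one or two
    points are the base cases, since \<open>helly\<close> takes three.\<close>
  have clique: "common (Suc (Suc k)) K" if "K \<subseteq> T" "clique (gaifman ?U) K" for K
    using that
  proof (induction "card K" arbitrary: K rule: less_induct)
    case less
    have fin: "finite K" using less.prems(1) assms(1) by (rule finite_subset)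
    obtain a where a: "a \<in> K" using less.prems(2) by (auto simp: clique_def)
    show ?case
    proof (cases "K = {a}")
      case True
      then have "inside (Suc (Suc k)) a (snd a)"
        using lies_refl[of "fst a" "Suc (Suc k)" "snd a"] T less.prems(1) by (auto simp: inside_def)
      then show ?thesis using True by (auto simp: common_def)
    next
      case False
      then obtain b where b: "b \<in> K" "b \<noteq> a" using a by blast
      show ?thesis
      proof (cases "K = {a, b}")
        case True
        have "gaifman ?U a b" using less.prems(2) a b by (auto simp: clique_def)
        then have "common (Suc k) K" using gaifman_iff gaifman_in True by blast
        then show ?thesis using stable[OF less.prems(1)] common_Suc by blast
      next
        case False
        then obtain c where c: "c \<in> K" "c \<noteq> a" "c \<noteq> b" using a b by blast
        have "common (Suc (Suc k)) (K - {t})" if "t \<in> K" for t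
        proof (rule less.hyps)
          show "card (K - {t}) < card K" using that fin by (meson card_Diff1_less)
          have "K - {t} \<noteq> {}" using a b by blast
          then show "clique (gaifman ?U) (K - {t})"
            using less.prems(2) by (simp add: clique_def)
        qed (use less.prems(1) in auto)
        then obtain x where x: "\<And>t. t \<in> K \<Longrightarrow> \<forall>s \<in> K - {t}. inside (Suc (Suc k)) s (x t)"
          unfolding common_def by metis
        have "\<exists>x. \<forall>s \<in> K. inside k s x"
          by (rule helly[of a K b c k "x a" "x b" "x c"]) (use a b c x in auto)
        then have "common k K" by (simp add: common_def)
        then show ?thesis using stable[OF less.prems(1)] by blast
      qed
    qed
  qed
  have conformal: "\<exists>u \<in> ?U. K \<subseteq> u" if K: "K \<subseteq> T" "clique (gaifman ?U) K" for K
  proof -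
    obtain v where v: "\<forall>s \<in> K. inside (Suc k) s v"
      using common_Suc[OF clique[OF K]] by (auto simp: common_def)
    have "K \<noteq> {}" using K(2) by (simp add: clique_def)
    then have "{s. inside (Suc k) s v} \<inter> T \<noteq> {}" using v K(1) by blast
    then have "{s. inside (Suc k) s v} \<inter> T \<in> ?U" unfolding induced_hyperedges_def by blast
    moreover have "K \<subseteq> {s. inside (Suc k) s v} \<inter> T" using v K(1) by blast
    ultimately show ?thesis by (rule bexI[rotated])
  qed
  show ?thesis
    unfolding hg_acyclic_def
  proof (intro conjI allI impI notI)
    assume "\<exists>xs. set xs \<subseteq> T \<and> length xs > 3 \<and> cycle (gaifman ?U) xs \<and> chordless (gaifman ?U) xs"
    then show False using no_cycle by (elim exE conjE)
  qed (rule conformal)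
qed

end

text \<open>Otherwise each of the \<open>M + 1\<close> double steps that start at 0, 2, ...,
  \<open>2 * M\<close> would lower a value that is at most \<open>M\<close> initially.\<close>

lemma antimono_stable:
  fixes f :: "nat \<Rightarrow> nat"
  assumes "\<And>k. f (Suc k) \<le> f k" "f 0 \<le> M"
  shows "\<exists>k \<le> 2 * M. f (Suc (Suc k)) = f k"
proof (rule ccontr)
  assume none: "\<not> ?thesis"
  have "f (2 * i) + i \<le> f 0" if "i \<le> Suc M" for i
    using that
  proof (induction i)
    case (Suc i)
    have "f (Suc (Suc (2 * i))) < f (2 * i)"
      using assms(1)[of "2 * i"] assms(1)[of "Suc (2 * i)"] none[simplified, rule_format, of "2 * i"]
        Suc.prems by simp
    then show ?case using Suc by simp
  qed simp
  from this[of "Suc M"] show False using assms(2) by simp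
qed

context partial_perms
begin

text \<open>The family of subsets of \<open>S\<close> with a common chart shrinks as the level
  rises, and it has at most \<open>2 ^ N\<close> members. The level \<open>k\<close> depends on
  \<open>S\<close>, its bound only on \<open>N\<close>; hence one finite quotient can serve all
  configurations.\<close>

lemma stable_level:
  assumes "finite S" "card S \<le> N"
  obtains k where "k \<le> 2 * 2 ^ N" "\<And>D. D \<subseteq> S \<Longrightarrow> common k D \<Longrightarrow> common (Suc (Suc k)) D"
proof -
  let ?F = "\<lambda>k. {D \<in> Pow S. common k D}"
  have fin: "finite (?F k)" for k using assms(1) by simp
  have mono: "?F (Suc k) \<subseteq> ?F k" for k using common_Suc by blast
  have "card (?F 0) \<le> card (Pow S)" using assms(1) by (intro card_mono) auto
  also have "\<dots> \<le> 2 ^ N" using assms by (simp add: card_Pow power_increasing)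
  finally have "card (?F 0) \<le> 2 ^ N" .
  moreover have "card (?F (Suc k)) \<le> card (?F k)" for k using mono by (intro card_mono fin)
  ultimately obtain k where k: "k \<le> 2 * 2 ^ N" "card (?F (Suc (Suc k))) = card (?F k)"
    using antimono_stable[of "\<lambda>k. card (?F k)" "2 ^ N"] by blast
  have "?F (Suc (Suc k)) \<subseteq> ?F k" using mono[of k] mono[of "Suc k"] by (rule subset_trans[rotated])
  then have eq: "?F (Suc (Suc k)) = ?F k" using k(2) by (rule card_subset_eq[OF fin])
  have "common (Suc (Suc k)) D" if "D \<subseteq> S" "common k D" for D
  proof -
    have "D \<in> ?F k" using that by simp
    then have "D \<in> ?F (Suc (Suc k))" using eq by simp
    then show ?thesis by simp
  qed
  with k(1) show ?thesis by (rule that)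
qed

end

section \<open>The finite solution\<close>

text \<open>In a finite set the complements of domain and range have the same size.\<close>

lemma extend_partial_injection:
  assumes "finite A" "dom p \<subseteq> A" "ran p \<subseteq> A" "inj_on p (dom p)"
  shows "\<exists>f. bij_betw f A A \<and> (\<forall>a b. p a = Some b \<longrightarrow> f a = b)"
proof -
  let ?p = "\<lambda>a. the (p a)"
  have bij: "bij_betw ?p (dom p) (ran p)"
    unfolding bij_betw_def
  proof
    show "inj_on ?p (dom p)"
      using assms(4) by (auto simp: inj_on_def) (metis domI option.sel)
    show "?p ` dom p = ran p" by (force simp: ran_def dom_def image_iff)
  qed
  have fin: "finite (dom p)" "finite (ran p)" using assms(1-3) finite_subset by blast+
  have "card (A - dom p) = card (A - ran p)"
    using bij_betw_same_card[OF bij] assms(2,3) fin by (simp add: card_Diff_subset)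
  then obtain g where g: "bij_betw g (A - dom p) (A - ran p)"
    using assms(1) by (meson finite_Diff finite_same_card_bij)
  let ?f = "\<lambda>a. if a \<in> dom p then ?p a else g a"
  have "bij_betw ?f (dom p \<union> (A - dom p)) (ran p \<union> (A - ran p))"
  proof (rule bij_betw_combine)
    show "bij_betw ?f (dom p) (ran p)" using bij by (simp cong: bij_betw_cong)
    have "bij_betw ?f (A - dom p) (A - ran p) \<longleftrightarrow> bij_betw g (A - dom p) (A - ran p)"
      by (rule bij_betw_cong) simp
    then show "bij_betw ?f (A - dom p) (A - ran p)" using g by simp
  qed auto
  then have "bij_betw ?f A A" using assms(2,3) by (simp add: Un_absorb1)
  then show ?thesis by (intro exI[of _ ?f]) auto
qed

context partial_perms
begin

lemma lies_trans:
  assumes "lies k s (snd t) (fst t)"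
  shows "lies k s v b \<longleftrightarrow> lies k t v b"
proof
  assume "lies k s v b"
  then obtain u where "run u (fst t) = Some b" "eqv k (snd t @ u) v"
    using lies_path[OF assms] by blast
  then show "lies k t v b" using lies_in[OF assms] by (auto simp: lies_def)
next
  assume "lies k t v b"
  then obtain u where u: "run u (fst t) = Some b" "eqv k (snd t @ u) v" by (auto simp: lies_def)
  show "lies k s v b" by (rule lies_cong[OF lies_run[OF assms u(1)] u(2)])
qed

text \<open>Two pairs are glued if the first lies in the chart of the second as the copy of its
  element. The classes are numbered because the finite solution is to live over \<open>nat\<close>.
  They are finite in number since the class of \<open>(a, w)\<close> depends only on
  \<open>a\<close> and on \<open>w\<close> modulo \<open>eqv k\<close>.\<close>

lemma point_code:
  assumes "finite L"
  shows "\<exists>code :: 'a \<times> 'l word \<Rightarrow> nat. finite (code ` (A \<times> lists (L \<times> UNIV))) \<and>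
    (\<forall>s \<in> A \<times> lists (L \<times> UNIV). \<forall>t \<in> A \<times> lists (L \<times> UNIV).
      code s = code t \<longleftrightarrow> lies k s (snd t) (fst t))"
proof -
  let ?Pt = "A \<times> lists (L \<times> UNIV)"
  let ?cls = "\<lambda>s. {t. lies k s (snd t) (fst t)}"
  have cls_iff: "?cls s = ?cls t \<longleftrightarrow> lies k s (snd t) (fst t)" if "fst t \<in> A" for s t
  proof
    assume "?cls s = ?cls t"
    moreover have "t \<in> ?cls t" using lies_refl[OF that, of k "snd t"] by simp
    ultimately show "lies k s (snd t) (fst t)" by blast
  next
    assume "lies k s (snd t) (fst t)"
    then show "?cls s = ?cls t" using lies_trans by blast
  qed
  have fin: "finite (?cls ` ?Pt)"
  proof (rule finite_image_factor)
    have "(\<lambda>s. (fst s, eqv k (snd s))) ` ?Pt \<subseteq> A \<times> eqv k ` lists (L \<times> UNIV)" by auto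
    then show "finite ((\<lambda>s. (fst s, eqv k (snd s))) ` ?Pt)"
      by (rule finite_subset) (intro finite_cartesian_product finite_A finite_eqv assms)
  next
    fix s t assume s: "s \<in> ?Pt" "t \<in> ?Pt" and eq: "(fst s, eqv k (snd s)) = (fst t, eqv k (snd t))"
    then have "eqv k (snd s) (snd t)" "fst s = fst t" using eqv_refl by simp_all
    then have "lies k s (snd t) (fst t)"
      using s lies_cong[OF lies_refl[of "fst s" k "snd s"]] by auto
    moreover have "fst t \<in> A" using s by auto
    ultimately show "?cls s = ?cls t" using cls_iff by blast
  qed
  obtain f :: "('a \<times> 'l word) set \<Rightarrow> nat" where f: "inj_on f (?cls ` ?Pt)"
    using finite_imp_inj_to_nat_seg[OF fin] by (elim exE conjE)
  show ?thesis
  proof (intro exI[of _ "\<lambda>s. f (?cls s)"] conjI ballI)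
    show "finite ((\<lambda>s. f (?cls s)) ` ?Pt)"
      using finite_imageI[OF fin, of f] by (simp add: image_image)
    show "f (?cls s) = f (?cls t) \<longleftrightarrow> lies k s (snd t) (fst t)" if "s \<in> ?Pt" "t \<in> ?Pt" for s t
    proof -
      have "f (?cls s) = f (?cls t) \<longleftrightarrow> ?cls s = ?cls t"
        using f that by (intro inj_on_eq_iff) auto
      also have "\<dots> \<longleftrightarrow> lies k s (snd t) (fst t)" using that by (intro cls_iff) auto
      finally show ?thesis .
    qed
  qed
qed

end

text \<open>The top level \<open>K\<close> is fixed from here on, and \<open>code\<close> names the
  glued points. Positivity of \<open>K\<close> leaves one level to spend on
  \<open>transition\<close>.\<close>

locale quotient = partial_perms "universe A\<^sub>0" act perm
  for A\<^sub>0 :: "('s, 'a) struct" and act :: "'l \<Rightarrow> 'a \<rightharpoonup> 'a" and perm :: "'l \<Rightarrow> 'a \<Rightarrow> 'a" +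
  fixes \<sigma> :: "'s signature" and L :: "'l set" and K :: nat
    and code :: "'a \<times> 'l word \<Rightarrow> nat"
  assumes A\<^sub>0: "A\<^sub>0 \<in> Str \<sigma>"
    and act_rel: "list_all2 (\<lambda>a b. act l a = Some b) as bs \<Longrightarrow> as \<in> rel A\<^sub>0 R \<longleftrightarrow> bs \<in> rel A\<^sub>0 R"
    and K_pos: "K > 0"
    and finite_code: "finite (code ` (universe A\<^sub>0 \<times> lists (L \<times> UNIV)))"
    and code_iff: "s \<in> universe A\<^sub>0 \<times> lists (L \<times> UNIV) \<Longrightarrow> t \<in> universe A\<^sub>0 \<times> lists (L \<times> UNIV) \<Longrightarrow>
      code s = code t \<longleftrightarrow> lies K s (snd t) (fst t)"
begin

abbreviation points :: "('a \<times> 'l word) set" where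
  "points \<equiv> universe A\<^sub>0 \<times> lists (L \<times> UNIV)"

definition M :: "('s, nat) struct" where
  "M = \<lparr> universe = code ` points,
     rel = (\<lambda>R. {map (\<lambda>a. code (a, w)) as | as w. as \<in> rel A\<^sub>0 R \<and> w \<in> lists (L \<times> UNIV)}) \<rparr>"

lemma Cons_points: "(a, w) \<in> points \<Longrightarrow> fst x \<in> L \<Longrightarrow> (a, x # w) \<in> points"
  by (cases x) auto

lemma universe_M: "universe M = code ` points"
  by (simp add: M_def)

lemma rel_M: "ns \<in> rel M R \<longleftrightarrow>
    (\<exists>as w. ns = map (\<lambda>a. code (a, w)) as \<and> as \<in> rel A\<^sub>0 R \<and> w \<in> lists (L \<times> UNIV))"
  by (auto simp: M_def)

lemma M_Str: "M \<in> Str \<sigma>"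
proof -
  have "universe A\<^sub>0 \<noteq> {}" using A\<^sub>0 by (simp add: Str_def)
  then have "universe M \<noteq> {}" by (auto simp: universe_M)
  moreover have "rel M R = {}" if "R \<notin> symbols \<sigma>" for R
    using A\<^sub>0 that by (auto simp: Str_def rel_M)
  moreover have "length ns = arity \<sigma> R \<and> set ns \<subseteq> universe M"
    if R: "R \<in> symbols \<sigma>" and ns: "ns \<in> rel M R" for R ns
  proof -
    obtain as w where as: "ns = map (\<lambda>a. code (a, w)) as" "as \<in> rel A\<^sub>0 R" "w \<in> lists (L \<times> UNIV)"
      using ns by (auto simp: rel_M)
    moreover have "length as = arity \<sigma> R" using A\<^sub>0 R as(2) by (auto simp: Str_def)
    ultimately show ?thesis using Str_tuple[OF A\<^sub>0 as(2)] by (auto simp: universe_M)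
  qed
  ultimately show ?thesis by (auto simp: Str_def)
qed

lemma step_rel:
  assumes "list_all2 (\<lambda>a b. step x a = Some b) as bs"
  shows "as \<in> rel A\<^sub>0 R \<longleftrightarrow> bs \<in> rel A\<^sub>0 R"
proof (cases "snd x")
  case True
  then show ?thesis using act_rel assms by (simp add: step_def)
next
  case False
  then have "list_all2 (\<lambda>b a. act (fst x) b = Some a) bs as"
    using assms by (simp add: step_def step_False_iff list_all2_conv_all_nth)
  then show ?thesis using act_rel by blast
qed

lemma run_rel:
  "list_all2 (\<lambda>a b. run u a = Some b) as bs \<Longrightarrow> as \<in> rel A\<^sub>0 R \<longleftrightarrow> bs \<in> rel A\<^sub>0 R"
proof (induction u arbitrary: as)
  case Nil
  then have "as = bs" by (simp add: list_all2_eq)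
  then show ?case by simp
next
  case (Cons x u)
  let ?cs = "map (\<lambda>a. the (step x a)) as"
  have "list_all2 (\<lambda>a b. step x a = Some b) as ?cs" "list_all2 (\<lambda>a b. run u a = Some b) ?cs bs"
    using Cons.prems by (auto simp: list_all2_conv_all_nth map_comp_Some_iff)
  then show ?case using step_rel Cons.IH by blast
qed

definition emb :: "'a \<rightharpoonup> nat" where
  "emb a = (if a \<in> universe A\<^sub>0 then Some (code (a, [])) else None)"

lemma emb_inj: "inj_on emb (dom emb)"
proof (rule inj_onI)
  fix a b assume "a \<in> dom emb" "b \<in> dom emb" "emb a = emb b"
  then have "a \<in> universe A\<^sub>0" "b \<in> universe A\<^sub>0" "code (a, []) = code (b, [])"
    by (auto simp: emb_def dom_def split: if_splits)
  then have "lies K (a, []) [] b" "lies K (a, []) [] a" using code_iff lies_refl by auto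
  then show "a = b" using lies_unique by blast
qed

text \<open>The point at issue is that relations are reflected: a tuple in the base chart may owe
  its membership to another chart \<open>w\<close>. The transition word from \<open>[]\<close> to
  \<open>w\<close> carries all its entries at once, and runs of words preserve and reflect the
  relations of \<open>A\<^sub>0\<close>.\<close>

lemma embedding_emb: "embedding A\<^sub>0 M emb"
proof -
  have dom: "dom emb = universe A\<^sub>0" by (auto simp: emb_def dom_def)
  have ran: "ran emb = (\<lambda>a. code (a, [])) ` universe A\<^sub>0" by (auto simp: emb_def ran_def)
  have emb: "map (\<lambda>a. the (emb a)) as = map (\<lambda>a. code (a, [])) as" if "set as \<subseteq> universe A\<^sub>0" for as
    using that by (auto simp: emb_def)
  have "as \<in> rel A\<^sub>0 R \<longleftrightarrow> map (\<lambda>a. code (a, [])) as \<in> rel M R" if as: "set as \<subseteq> universe A\<^sub>0" for as R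
  proof
    assume "map (\<lambda>a. code (a, [])) as \<in> rel M R"
    then obtain bs w where bs: "map (\<lambda>a. code (a, [])) as = map (\<lambda>a. code (a, w)) bs"
      "bs \<in> rel A\<^sub>0 R" "w \<in> lists (L \<times> UNIV)"
      by (auto simp: rel_M)
    have len: "length as = length bs" using bs(1) by (rule map_eq_imp_length_eq)
    have lies: "lies K (as ! i, []) w (bs ! i)" "lies K (as ! i, []) [] (as ! i)"
      if i: "i < length as" for i
    proof -
      have "as ! i \<in> universe A\<^sub>0" "bs ! i \<in> universe A\<^sub>0"
        using as Str_tuple[OF A\<^sub>0 bs(2)] i len by (auto dest: nth_mem)
      moreover have "code (as ! i, []) = code (bs ! i, w)"
        using arg_cong[OF bs(1), of "\<lambda>ns. ns ! i"] i len by simp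
      ultimately show "lies K (as ! i, []) w (bs ! i)" "lies K (as ! i, []) [] (as ! i)"
        using code_iff bs(3) lies_refl by auto
    qed
    obtain K' where K': "K = Suc K'" using K_pos by (cases K) auto
    show "as \<in> rel A\<^sub>0 R"
    \<comment> \<open>The empty tuple has no entry from which \<open>transition\<close> could
      start.\<close>
    proof (cases "as = []")
      case True
      then show ?thesis using bs(2) len by simp
    next
      case False
      then have "inside K (as ! 0, []) []" "inside K (as ! 0, []) w"
        using lies[of 0] by (auto simp: inside_def)
      then obtain u where u: "\<forall>s b b'. lies K s [] b \<longrightarrow> lies K s w b' \<longrightarrow> run u b = Some b'"
        using transition[of K' "(as ! 0, [])" "[]" w] unfolding K' by blast
      have "list_all2 (\<lambda>a b. run u a = Some b) as bs"
        using len u[rule_format, OF lies(2) lies(1)] by (simp add: list_all2_conv_all_nth)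
      then show ?thesis using run_rel bs(2) by blast
    qed
  next
    assume "as \<in> rel A\<^sub>0 R"
    moreover have "[] \<in> lists (L \<times> UNIV)" by simp
    ultimately show "map (\<lambda>a. code (a, [])) as \<in> rel M R" unfolding rel_M by blast
  qed
  then have "as \<in> rel A\<^sub>0 R \<longleftrightarrow> map (\<lambda>a. the (emb a)) as \<in> rel (induced M (ran emb)) R"
    if "set as \<subseteq> universe A\<^sub>0" for as R
    unfolding emb[OF that] using that by (auto simp: induced_def ran)
  then show ?thesis
    using dom emb_inj by (auto simp: embedding_def iso_def induced_def ran universe_M)
qed

definition shift :: "'l \<times> bool \<Rightarrow> nat \<rightharpoonup> nat" where
  "shift x n = (if n \<in> universe M then
     let s = inv_into points code n in Some (code (fst s, x # snd s)) else None)"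

text \<open>\<open>shift x\<close> is left multiplication by \<open>x\<close>. Gluing multiplies
  words on the right and so commutes with it, which makes the choice of representative in the
  definition immaterial.\<close>

lemma shift_code:
  assumes s: "(a, w) \<in> points" and x: "fst x \<in> L"
  shows "shift x (code (a, w)) = Some (code (a, x # w))"
proof -
  let ?s = "inv_into points code (code (a, w))"
  have "?s \<in> points" "code ?s = code (a, w)"
    using s by (auto intro: inv_into_into f_inv_into_f)
  then have "lies K ?s w a" using code_iff[of ?s "(a, w)"] s by simp
  then obtain u where u: "run u (fst ?s) = Some a" "eqv K (snd ?s @ u) w" "fst ?s \<in> universe A\<^sub>0"
    by (auto simp: lies_def)
  have "lies K (fst ?s, x # snd ?s) (x # w) a"
    using u eqv_left[OF u(2), of "[x]"] by (auto simp: lies_def)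
  then have "code (fst ?s, x # snd ?s) = code (a, x # w)"
    using code_iff[OF Cons_points Cons_points[OF s x], of "fst ?s" "snd ?s"] x \<open>?s \<in> points\<close>
    by simp
  moreover have "code (a, w) \<in> universe M" using s by (simp add: universe_M)
  ultimately show ?thesis by (simp add: shift_def Let_def)
qed

lemma shift_flip:
  assumes "fst x \<in> L" "n \<in> universe M"
  shows "shift x (the (shift (flip x) n)) = Some n"
proof -
  obtain a w where s: "(a, w) \<in> points" "n = code (a, w)" using assms(2) by (auto simp: universe_M)
  have fx: "fst (flip x) \<in> L" using assms(1) by (simp add: flip_def)
  have s': "(a, flip x # w) \<in> points" "(a, x # flip x # w) \<in> points"
    using Cons_points s(1) fx assms(1) by blast+
  have "eqv K ((x # flip x # w) @ []) w" using eqv_right[OF eqv_flip[of K x], of w] by simp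
  then have "lies K (a, x # flip x # w) w a"
    using s(1) by (auto simp: lies_def intro!: exI[of _ "[]"])
  then have "code (a, x # flip x # w) = code (a, w)" using code_iff[OF s'(2) s(1)] by simp
  then show ?thesis using shift_code[OF s(1) fx] shift_code[OF s'(1) assms(1)] s(2) by simp
qed

lemma automorphism_shift:
  assumes x: "fst x \<in> L"
  shows "automorphism M (shift x)"
proof -
  have fx: "fst (flip y) \<in> L" if "fst y \<in> L" for y :: "'l \<times> bool" using that by (simp add: flip_def)
  have dom: "dom (shift y) = universe M" for y by (auto simp: shift_def dom_def Let_def)
  have into: "the (shift y n) \<in> universe M" if y: "fst y \<in> L" and n: "n \<in> universe M" for y n
  proof -
    obtain a w where s: "(a, w) \<in> points" "n = code (a, w)" using n by (auto simp: universe_M)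
    have "the (shift y n) = code (a, y # w)" using shift_code[OF s(1) y] s(2) by simp
    then show ?thesis using Cons_points[OF s(1) y] unfolding universe_M by blast
  qed
  have Some: "shift y n = Some (the (shift y n))" if "n \<in> universe M" for y n
  proof -
    have "n \<in> dom (shift y)" using that dom by simp
    then show ?thesis by (simp add: domIff)
  qed
  have "ran (shift x) = universe M"
  proof
    show "ran (shift x) \<subseteq> universe M"
      using into[OF x] dom[of x] by (fastforce simp: ran_def dom_def)
    show "universe M \<subseteq> ran (shift x)" using shift_flip[OF x] by (auto simp: ran_def)
  qed
  moreover have "inj_on (shift x) (dom (shift x))"
  proof (rule inj_onI)
    fix m n assume "m \<in> dom (shift x)" "n \<in> dom (shift x)" "shift x m = shift x n"
    then show "m = n" using shift_flip[OF fx[OF x], of m] shift_flip[OF fx[OF x], of n] dom by simp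
  qed
  moreover have shift_rel: "map (\<lambda>n. the (shift y n)) ns \<in> rel M R"
    if y: "fst y \<in> L" and ns: "ns \<in> rel M R" for y ns R
  proof -
    obtain as w where as: "ns = map (\<lambda>a. code (a, w)) as" "as \<in> rel A\<^sub>0 R" "w \<in> lists (L \<times> UNIV)"
      using ns by (auto simp: rel_M)
    have "the (shift y (code (a, w))) = code (a, y # w)" if "a \<in> set as" for a
      using shift_code[of a w, OF _ y] Str_tuple[OF A\<^sub>0 as(2)] that as(3) by auto
    then have "map (\<lambda>n. the (shift y n)) ns = map (\<lambda>a. code (a, y # w)) as" using as(1) by simp
    moreover have "y # w \<in> lists (L \<times> UNIV)" using as(3) y by (cases y) auto
    ultimately show ?thesis using as(2) unfolding rel_M by blast
  qed
  moreover have "ns \<in> rel M R"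
    if "set ns \<subseteq> universe M" "map (\<lambda>n. the (shift x n)) ns \<in> rel M R" for ns R
  proof -
    have "map (\<lambda>n. the (shift (flip x) n)) (map (\<lambda>n. the (shift x n)) ns) = ns"
      using that(1) shift_flip[OF fx[OF x]] by (auto intro!: map_idI)
    then show ?thesis using shift_rel[OF fx[OF x] that(2)] by simp
  qed
  ultimately show ?thesis using dom x unfolding automorphism_def iso_def by blast
qed

text \<open>The inverse letter is the correct one: \<open>a\<close> in the base chart moves to
  \<open>a\<close> in the chart of \<open>[(l, False)]\<close>, which is glued to its image under
  \<open>act l\<close> in the chart of \<open>[(l, False), (l, True)]\<close>, and this is again the
  base chart.\<close>

lemma act_extends:
  assumes "l \<in> L"
  shows "emb \<circ>\<^sub>m act l \<circ>\<^sub>m map_inv emb \<subseteq>\<^sub>m shift (l, False)"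
proof (unfold map_le_def, rule ballI)
  fix n assume "n \<in> dom (emb \<circ>\<^sub>m act l \<circ>\<^sub>m map_inv emb)"
  then obtain m where m: "(emb \<circ>\<^sub>m act l \<circ>\<^sub>m map_inv emb) n = Some m" by blast
  then obtain a b where ab: "map_inv emb n = Some a" "act l a = Some b" "emb b = Some m"
    by (auto simp: map_comp_Some_iff)
  have "n \<in> ran emb" using ab(1) by (auto simp: map_inv_def split: if_splits)
  then obtain a' where a': "emb a' = Some n" by (auto simp: ran_def)
  then have "a' = a" using map_inv_eq_Some[OF emb_inj a'] ab(1) by simp
  then have a: "a \<in> universe A\<^sub>0" "n = code (a, [])" and b: "b \<in> universe A\<^sub>0" "m = code (b, [])"
    using a' ab(3) by (auto simp: emb_def split: if_splits)
  have "eqv K ([(l, False)] @ [(l, True)]) []" using eqv_flip[of K "(l, False)"] by (simp add: flip_def)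
  moreover have "run [(l, True)] a = Some b" using ab(2) by (simp add: step_def)
  ultimately have "lies K (a, [(l, False)]) [] b"
    using a(1) by (auto simp: lies_def intro!: exI[of _ "[(l, True)]"])
  then have "code (a, [(l, False)]) = code (b, [])"
    using code_iff[of "(a, [(l, False)])" "(b, [])"] a(1) b(1) assms by simp
  then have "shift (l, False) n = Some m" using shift_code[of a "[]" "(l, False)"] a b assms by simp
  then show "(emb \<circ>\<^sub>m act l \<circ>\<^sub>m map_inv emb) n = shift (l, False) n" using m by simp
qed

section \<open>Homomorphisms from small parts of the quotient\<close>

lemma run_autos:
  assumes real: "realizes A\<^sub>0 (range act) B \<epsilon>"
  shows "\<exists>g \<in> autos B. \<forall>a b. run u a = Some b \<longrightarrow> g (\<epsilon> a) = \<epsilon> b"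
proof (induction u)
  case Nil
  then show ?case by (intro bexI[OF _ id_autos]) simp
next
  case (Cons x u)
  then obtain g where g: "g \<in> autos B" "\<forall>a b. run u a = Some b \<longrightarrow> g (\<epsilon> a) = \<epsilon> b" by blast
  obtain f where f: "f \<in> autos B" "\<forall>a b. act (fst x) a = Some b \<longrightarrow> f (\<epsilon> a) = \<epsilon> b"
    using real unfolding realizes_def by blast
  obtain f' where f': "f' \<in> autos B" "\<And>y. y \<in> universe B \<Longrightarrow> f' (f y) = y"
    using inv_autos[OF f(1)] by blast
  have into: "\<epsilon> a \<in> universe B" if "a \<in> universe A\<^sub>0" for a
    using real that unfolding realizes_def by blast
  obtain h where h: "h \<in> autos B" "\<forall>a b. step x a = Some b \<longrightarrow> h (\<epsilon> a) = \<epsilon> b"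
  proof (cases "snd x")
    case True
    then show ?thesis using that[OF f(1)] f(2) by (simp add: step_def)
  next
    case False
    have "f' (\<epsilon> a) = \<epsilon> b" if "step x a = Some b" for a b
    proof -
      have "act (fst x) b = Some a" using that False by (simp add: step_def step_False_iff)
      then show ?thesis using f(2) f'(2)[OF into[OF act_dom]] by metis
    qed
    then show ?thesis using that[OF f'(1)] by blast
  qed
  have "(g \<circ> h) (\<epsilon> a) = \<epsilon> b" if "run (x # u) a = Some b" for a b
    using that g(2) h(2) by (auto simp: map_comp_Some_iff)
  then show ?case using comp_autos[OF g(1) h(1)] by blast
qed

text \<open>As a set of representatives, \<open>S\<close> can be read at its own stable level
  \<open>k\<close>. At level \<open>k + 1\<close> the charts are acyclic on \<open>S\<close> and
  their transitions are runs of words, so the charts can be glued. Since \<open>k + 1\<close> is at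
  most \<open>K\<close>, a tuple that lies in one chart at level \<open>K\<close> also lies in one
  chart at level \<open>k + 1\<close>.\<close>

lemma local_hom:
  assumes real: "realizes A\<^sub>0 (range act) B \<epsilon>"
    and S: "finite S" "card S \<le> N" "fst ` S \<subseteq> universe A\<^sub>0" and K: "K = 2 * 2 ^ N + 2"
  obtains h where "h ` S \<subseteq> universe B"
    "\<And>R ss v as. set ss \<subseteq> S \<Longrightarrow> list_all2 (\<lambda>s a. lies K s v a) ss as \<Longrightarrow> as \<in> rel A\<^sub>0 R \<Longrightarrow>
      map h ss \<in> rel B R"
proof -
  obtain k where k: "k \<le> 2 * 2 ^ N" "\<And>D. D \<subseteq> S \<Longrightarrow> common k D \<Longrightarrow> common (Suc (Suc k)) D"
    using stable_level[OF S(1,2)] by blast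
  define pos where "pos v s =
    (if inside (Suc k) s v then Some (THE b. lies (Suc k) s v b) else None)" for v s
  have pos: "pos v s = Some b \<longleftrightarrow> lies (Suc k) s v b" for v s b
  proof -
    have "(THE b. lies (Suc k) s v b) = b" if "lies (Suc k) s v b" for b
      using that lies_unique by (intro the_equality) blast+
    then show ?thesis by (auto simp: pos_def inside_def)
  qed
  have dom_pos: "dom (pos v) = {s. inside (Suc k) s v}" for v by (auto simp: pos_def dom_def)
  have into: "\<epsilon> a \<in> universe B" if "a \<in> universe A\<^sub>0" for a
    using real that unfolding realizes_def by blast
  have "\<exists>h. \<forall>v \<in> UNIV. \<exists>g \<in> autos B. \<forall>s \<in> S. \<forall>a. pos v s = Some a \<longrightarrow> h s = g (\<epsilon> a)"
  proof (rule glue_charts[OF S(1)])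
    fix T assume T: "T \<subseteq> S"
    show "hg_acyclic T (induced_hyperedges (range (\<lambda>v. dom (pos v))) T)"
      unfolding dom_pos
    proof (rule acyclic_of_stable)
      show "finite T" using T S(1) by (rule finite_subset)
      show "fst s \<in> universe A\<^sub>0" if "s \<in> T" for s using that T S(3) by blast
      show "common (Suc (Suc k)) D" if "D \<subseteq> T" "common k D" for D using that T k(2) by blast
    qed
  next
    have "s \<in> dom (pos (snd s))" if "s \<in> S" for s
    proof -
      have "lies (Suc k) s (snd s) (fst s)" using that S(3) lies_refl[of "fst s" "Suc k" "snd s"] by auto
      then show ?thesis using pos by blast
    qed
    then show "S \<subseteq> (\<Union>v. dom (pos v))" by blast
  next
    fix v v' t assume "t \<in> S \<inter> dom (pos v) \<inter> dom (pos v')"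
    then have t: "inside (Suc k) t v" "inside (Suc k) t v'" by (simp_all add: dom_pos)
    obtain u where u: "\<forall>s b b'. lies (Suc k) s v b \<longrightarrow> lies (Suc k) s v' b' \<longrightarrow> run u b = Some b'"
      using transition[OF t] by blast
    obtain g where "g \<in> autos B" "\<forall>a b. run u a = Some b \<longrightarrow> g (\<epsilon> a) = \<epsilon> b"
      using run_autos[OF real] by blast
    then show "\<exists>g \<in> autos B. \<forall>s \<in> S. \<forall>a b. pos v s = Some a \<longrightarrow> pos v' s = Some b \<longrightarrow> g (\<epsilon> a) = \<epsilon> b"
      using u pos by blast
  next
    fix v s a assume "pos v s = Some a"
    then show "\<epsilon> a \<in> universe B" using pos lies_in into by blast
  qed
  then obtain h where h: "\<forall>v \<in> UNIV. \<exists>g \<in> autos B. \<forall>s \<in> S. \<forall>a. pos v s = Some a \<longrightarrow> h s = g (\<epsilon> a)"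
    by blast
  show ?thesis
  proof (rule that)
    show "h ` S \<subseteq> universe B"
    proof (rule image_subsetI)
      fix s assume s: "s \<in> S"
      then have a: "fst s \<in> universe A\<^sub>0" using S(3) by blast
      then have "pos (snd s) s = Some (fst s)"
        using lies_refl[of "fst s" "Suc k" "snd s"] by (simp add: pos)
      then obtain g where "g \<in> autos B" "h s = g (\<epsilon> (fst s))" using h s by blast
      then show "h s \<in> universe B" using autos_into into[OF a] by simp
    qed
    fix R ss v as
    assume ss: "set ss \<subseteq> S" "list_all2 (\<lambda>s a. lies K s v a) ss as" "as \<in> rel A\<^sub>0 R"
    have "Suc k \<le> K" using k(1) K by simp
    then have "list_all2 (\<lambda>s a. pos v s = Some a) ss as"
      using ss(2) lies_mono by (auto simp: pos elim: list_all2_mono)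
    then show "map h ss \<in> rel B R"
      using glued_hom[OF real h UNIV_I ss(1)] ss(3) Str_tuple[OF A\<^sub>0 ss(3)] by blast
  qed
qed

text \<open>A homomorphism from a forbidden structure to \<open>M\<close> is replaced by a choice of
  representatives, at most \<open>N\<close> in number. These are mapped to \<open>B\<close> by
  \<open>local_hom\<close>; each tuple of the forbidden structure falls into a single chart by the
  definition of \<open>M\<close>.\<close>

lemma M_Forb:
  assumes real: "realizes A\<^sub>0 (range act) B \<epsilon>" and K: "K = 2 * 2 ^ N + 2"
    and B: "B \<in> Forb \<sigma> X" and X: "forbidden_structures \<sigma> X" "\<forall>F \<in> X. card (universe F) \<le> N"
  shows "M \<in> Forb \<sigma> X"
proof -
  have "\<not> hom F M h" if F: "F \<in> X" for F h
  proof
    assume h: "hom F M h"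
    have F': "F \<in> Str \<sigma>" "finite (universe F)"
      using X(1) F by (auto simp: forbidden_structures_def fin_def)
    define r where "r x = inv_into points code (h x)" for x
    have r: "r x \<in> points" "code (r x) = h x" if "x \<in> universe F" for x
    proof -
      have "h x \<in> code ` points" using h that by (auto simp: hom_def universe_M)
      then show "r x \<in> points" "code (r x) = h x"
        unfolding r_def by (rule inv_into_into, rule f_inv_into_f)
    qed
    have "card (r ` universe F) \<le> N" using card_image_le[OF F'(2), of r] X(2) F by fastforce
    moreover have "fst ` r ` universe F \<subseteq> universe A\<^sub>0" using r(1) by fastforce
    ultimately obtain g where g: "g ` r ` universe F \<subseteq> universe B"
      "\<And>R ss v as. set ss \<subseteq> r ` universe F \<Longrightarrow> list_all2 (\<lambda>s a. lies K s v a) ss as \<Longrightarrow>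
        as \<in> rel A\<^sub>0 R \<Longrightarrow> map g ss \<in> rel B R"
      using local_hom[OF real finite_imageI[OF F'(2)] _ _ K] by blast
    have "map (g \<circ> r) xs \<in> rel B R" if xs: "xs \<in> rel F R" for R xs
    proof -
      have sub: "set xs \<subseteq> universe F" using Str_tuple[OF F'(1) xs] .
      have "map h xs \<in> rel M R" using h xs by (simp add: hom_def)
      then obtain as w where as: "map h xs = map (\<lambda>a. code (a, w)) as" "as \<in> rel A\<^sub>0 R"
        "w \<in> lists (L \<times> UNIV)" by (auto simp: rel_M)
      have len: "length xs = length as" using as(1) by (rule map_eq_imp_length_eq)
      have "lies K (r (xs ! i)) w (as ! i)" if i: "i < length xs" for i
      proof -
        have x: "xs ! i \<in> universe F" using sub i by auto
        have "as ! i \<in> universe A\<^sub>0" using Str_tuple[OF A\<^sub>0 as(2)] i len by auto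
        moreover have "code (r (xs ! i)) = code (as ! i, w)"
          using arg_cong[OF as(1), of "\<lambda>ns. ns ! i"] i len r(2)[OF x] by simp
        ultimately show ?thesis using code_iff[OF r(1)[OF x], of "(as ! i, w)"] as(3) by simp
      qed
      then have "list_all2 (\<lambda>s a. lies K s w a) (map r xs) as"
        using len by (simp add: list_all2_conv_all_nth)
      moreover have "set (map r xs) \<subseteq> r ` universe F" using sub by auto
      ultimately have "map g (map r xs) \<in> rel B R" using g(2) as(2) by blast
      then show ?thesis by simp
    qed
    then have "hom F B (g \<circ> r)" using g(1) by (auto simp: hom_def)
    then show False using B F by (auto simp: Forb_def)
  qed
  then show ?thesis using M_Str by (auto simp: Forb_def)
qed

end

section \<open>EPPA for classes given by forbidden homomorphisms\<close>

theorem EPPA_Forb: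
  fixes \<sigma> :: "'s signature" and X :: "('s, 'x) struct set"
  assumes X: "forbidden_structures \<sigma> X"
  shows "EPPA (Forb \<sigma> X :: ('s, 'a) struct set) (Forb \<sigma> X :: ('s, 'c) struct set) (Forb \<sigma> X)"
  unfolding EPPA_def
proof (intro allI impI)
  fix A\<^sub>0 :: "('s, 'a) struct" and P
  assume inst: "ext_instance (Forb \<sigma> X) A\<^sub>0 P"
    and "solutions (Forb \<sigma> X :: ('s, 'c) struct set) A\<^sub>0 P \<noteq> {}"
  then obtain B :: "('s, 'c) struct" where B: "B \<in> solutions (Forb \<sigma> X) A\<^sub>0 P" by blast
  obtain \<epsilon> where \<epsilon>: "realizes A\<^sub>0 P B \<epsilon>" using solution_realizes[OF inst Forb_subset_Str B] by blast
  have A0: "A\<^sub>0 \<in> Str \<sigma>" "finite (universe A\<^sub>0)"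
    using inst Forb_subset_Str by (auto simp: ext_instance_def fin_def)
  have P: "dom p \<subseteq> universe A\<^sub>0" "ran p \<subseteq> universe A\<^sub>0" "inj_on p (dom p)"
    "iso (induced A\<^sub>0 (dom p)) (induced A\<^sub>0 (ran p)) p" if "p \<in> P" for p
    using inst that by (auto simp: ext_instance_def partial_iso_def iso_def)
  have "finite P"
  proof (rule finite_subset)
    show "P \<subseteq> {p. dom p \<subseteq> universe A\<^sub>0 \<and> ran p \<subseteq> universe A\<^sub>0}" using P by blast
    have "{p. dom p \<subseteq> universe A\<^sub>0 \<and> ran p \<subseteq> universe A\<^sub>0} =
        (\<Union>D \<in> Pow (universe A\<^sub>0). {p. dom p = D \<and> ran p \<subseteq> universe A\<^sub>0})" by auto
    then show "finite {p :: 'a \<rightharpoonup> 'a. dom p \<subseteq> universe A\<^sub>0 \<and> ran p \<subseteq> universe A\<^sub>0}"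
      using A0(2) finite_set_of_finite_maps[OF finite_subset[OF _ A0(2)] A0(2)] by auto
  qed
  \<comment> \<open>The members of \<open>P\<close> serve as their own letters. The letter type
    contains all partial maps, so a permutation is chosen for each of them, the identity for those
    outside \<open>P\<close>.\<close>
  have "\<exists>f. bij_betw f (universe A\<^sub>0) (universe A\<^sub>0) \<and>
      (p \<in> P \<longrightarrow> (\<forall>a b. p a = Some b \<longrightarrow> f a = b))" for p
  proof (cases "p \<in> P")
    case True
    then show ?thesis using extend_partial_injection[OF A0(2) P(1-3)] by blast
  next
    case False
    then show ?thesis by (intro exI[of _ id]) simp
  qed
  then obtain perm where perm: "\<And>p. bij_betw (perm p) (universe A\<^sub>0) (universe A\<^sub>0)"
    "\<And>p a b. p \<in> P \<Longrightarrow> p a = Some b \<Longrightarrow> perm p a = b" by metis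
  \<comment> \<open>Letters outside \<open>P\<close> get the empty map, which glues nothing and is
    induced by the identity automorphism of \<open>B\<close>.\<close>
  define act where "act p = (if p \<in> P then p else Map.empty)" for p
  interpret partial_perms "universe A\<^sub>0" act perm
  proof unfold_locales
    show "a \<in> universe A\<^sub>0" if "act p a = Some b" for p a b
      using that P(1)[of p] by (auto simp: act_def split: if_splits)
  qed (use A0(2) perm in \<open>auto simp: act_def split: if_splits\<close>)
  obtain N where N: "\<forall>F \<in> X. card (universe F) \<le> N"
    using X finite_nat_set_iff_bounded_le[of "(card \<circ> universe) ` X"]
    by (auto simp: forbidden_structures_def)
  \<comment> \<open>A stable level \<open>k\<close> is at most \<open>2 * 2 ^ N\<close>; adding 2
    keeps \<open>k + 2\<close> within the chain.\<close>
  define K :: nat where "K = 2 * 2 ^ N + 2"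
  obtain code :: "'a \<times> ('a \<rightharpoonup> 'a) word \<Rightarrow> nat"
    where code: "finite (code ` (universe A\<^sub>0 \<times> lists (P \<times> UNIV)))"
    "\<forall>s \<in> universe A\<^sub>0 \<times> lists (P \<times> UNIV). \<forall>t \<in> universe A\<^sub>0 \<times> lists (P \<times> UNIV).
      code s = code t \<longleftrightarrow> lies K s (snd t) (fst t)"
    using point_code[OF \<open>finite P\<close>, of K] by blast
  interpret quotient A\<^sub>0 act perm \<sigma> P K code
  proof unfold_locales
    fix p as bs R assume ab: "list_all2 (\<lambda>a b. act p a = Some b) as bs"
    show "as \<in> rel A\<^sub>0 R \<longleftrightarrow> bs \<in> rel A\<^sub>0 R"
    proof (cases "p \<in> P")
      case True
      then have ab': "list_all2 (\<lambda>a b. p a = Some b) as bs" using ab by (simp add: act_def)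
      then have as: "set as \<subseteq> dom p" and bs: "map (\<lambda>a. the (p a)) as = bs"
        by (auto simp: list_all2_conv_all_nth in_set_conv_nth intro!: nth_equalityI)
      have "set bs \<subseteq> ran p"
      proof
        fix b assume "b \<in> set bs"
        then obtain i where "i < length bs" "b = bs ! i" by (auto simp: in_set_conv_nth)
        then have "p (as ! i) = Some b" using ab' by (simp add: list_all2_conv_all_nth)
        then show "b \<in> ran p" by (rule ranI)
      qed
      moreover have "as \<in> rel (induced A\<^sub>0 (dom p)) R \<longleftrightarrow> bs \<in> rel (induced A\<^sub>0 (ran p)) R"
        using P(4)[OF True] as by (simp add: iso_def induced_def flip: bs)
      ultimately show ?thesis using as by (simp add: induced_def)
    next
      case False
      then show ?thesis using ab by (cases as; cases bs) (auto simp: act_def)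
    qed
  next
    show "code s = code t \<longleftrightarrow> lies K s (snd t) (fst t)"
      if "s \<in> universe A\<^sub>0 \<times> lists (P \<times> UNIV)" "t \<in> universe A\<^sub>0 \<times> lists (P \<times> UNIV)" for s t
      by (rule code(2)[THEN bspec, THEN bspec]) (fact that)+
  qed (use A0 code(1) in \<open>simp_all add: K_def\<close>)
  have "realizes A\<^sub>0 (range act) B \<epsilon>"
    unfolding realizes_def
  proof (intro conjI ballI)
    fix q assume "q \<in> range act"
    then have "q \<in> P \<or> q = Map.empty" by (auto simp: act_def)
    then show "\<exists>g \<in> autos B. \<forall>a b. q a = Some b \<longrightarrow> g (\<epsilon> a) = \<epsilon> b"
      using \<epsilon> id_autos unfolding realizes_def by fastforce
  qed (use \<epsilon> in \<open>auto simp: realizes_def\<close>)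
  then have "M \<in> Forb \<sigma> X" using M_Forb[OF _ K_def _ X N] B by (auto simp: solutions_def)
  moreover have "\<exists>f. automorphism M f \<and> emb \<circ>\<^sub>m p \<circ>\<^sub>m map_inv emb \<subseteq>\<^sub>m f" if "p \<in> P" for p
  proof -
    have "act p = p" using that by (simp add: act_def)
    then show ?thesis using act_extends[OF that] automorphism_shift[of "(p, False)"] that by auto
  qed
  ultimately have "M \<in> fin (solutions (Forb \<sigma> X) A\<^sub>0 P)"
    using embedding_emb finite_code by (auto simp: fin_def solutions_def universe_M)
  then show "fin (solutions (Forb \<sigma> X :: ('s, nat) struct set) A\<^sub>0 P) \<noteq> {}" by blast
qed

theorem corollary5p12:
  fixes \<sigma> :: "'s signature"
  assumes "finite (symbols \<sigma>)"
  shows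
    "(\<forall>(A\<^sub>0 :: ('s, 'a) struct) P (A :: ('s, 'b) struct) \<Pi> N.
        ext_instance (Str \<sigma>) A\<^sub>0 P \<and>
        fully_symmetric_solution \<sigma> A\<^sub>0 P A \<Pi> \<and> finite (universe A) \<and>
        N_acyclic N (universe A) (dom ` \<Pi>) \<longrightarrow>
          N_universal N A (solutions (Str \<sigma>) A\<^sub>0 P :: ('s, 'c) struct set) \<and>
          (\<forall>X :: ('s, 'x) struct set.
             forbidden_structures \<sigma> X \<and> (\<forall>F \<in> X. card (universe F) \<le> N) \<and>
             solutions (Forb \<sigma> X :: ('s, 'c) struct set) A\<^sub>0 P \<noteq> {} \<longrightarrow>
               A \<in> fin (Forb \<sigma> X))) \<and>
     (\<forall>X :: ('s, 'x) struct set. forbidden_structures \<sigma> X \<longrightarrow>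
        EPPA (Forb \<sigma> X :: ('s, 'a) struct set)
             (Forb \<sigma> X :: ('s, 'c) struct set)
             (Forb \<sigma> X))"
proof (intro conjI allI impI; (elim conjE)?)
  fix A\<^sub>0 :: "('s, 'a) struct" and P and A :: "('s, 'b) struct" and \<Pi> N
  assume A: "ext_instance (Str \<sigma>) A\<^sub>0 P" "fully_symmetric_solution \<sigma> A\<^sub>0 P A \<Pi>" "finite (universe A)"
    "N_acyclic N (universe A) (dom ` \<Pi>)"
  show "N_universal N A (solutions (Str \<sigma>) A\<^sub>0 P :: ('s, 'c) struct set)"
    using A(1,2,4) by (rule N_universal_solutions)
  fix X :: "('s, 'x) struct set"
  assume X: "forbidden_structures \<sigma> X" "\<forall>F \<in> X. card (universe F) \<le> N"
    and "solutions (Forb \<sigma> X :: ('s, 'c) struct set) A\<^sub>0 P \<noteq> {}"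
  then obtain B :: "('s, 'c) struct" where B: "B \<in> solutions (Forb \<sigma> X) A\<^sub>0 P" by blast
  have "N_universal N A (solutions (Str \<sigma>) A\<^sub>0 P :: ('s, 'c) struct set)"
    using A(1,2,4) by (rule N_universal_solutions)
  moreover have "A \<in> Str \<sigma>" using A(2) by (simp add: fully_symmetric_solution_def solutions_def)
  moreover have "B \<in> solutions (Str \<sigma>) A\<^sub>0 P"
    by (rule subsetD[OF solutions_mono[OF Forb_subset_Str] B])
  moreover have "B \<in> Forb \<sigma> X" using B by (simp add: solutions_def)
  ultimately have "A \<in> Forb \<sigma> X" using X N_universal_Forb by blast
  then show "A \<in> fin (Forb \<sigma> X)" using A(3) by (simp add: fin_def)
qed (rule EPPA_Forb)

end
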